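(* Let $G$ be a planar electrical network (a cactus network whose shape is the partition of $[n]$ into singletons) with response matrix $L$, and let $X_G$ be the point of $\mathrm{Gr}(n+1,2n)$ with Plücker vector $[\sum_\sigma\Lambda_\sigma(G)f_\sigma]$. Then $X_G\in U_{\text{not shorted}}$, and writing $X_G$ as the row span of $MD$ with $M$ of the form below (with matrix $S$), the symmetric matrix $P$ with $P_{ab}=S_{b,a-1}-S_{b,a}$ (indices modulo $n$) equals $L$. Here $M$ is the $(n+1)\times 2n$ matrix whose first row is $(0,1,0,1,\dots,0,1)$ and whose $(i+1)$-st row has entry $1$ in column $i$, $0$ in the other columns $j\in[n]$, and $S_{ij}$ in column $\tilde j$; $D$ is diagonal with $D_{ii}=D_{\tilde i\tilde i}=(-1)^{i-1}$.
   Context: Setup: $V=\mathbb{R}^{2n}$ with basis $e_1,e_{\tilde1},\dots,e_n,e_{\tilde n}$ ordered $1<\tilde1<\dots<n<\tilde n$; $e_{I,\tilde I}$ is the ordered wedge of $e_i$, $i\in I\sqcup\tilde I$; Plücker coordinates $\Delta_{I,\tilde I}$ are the coefficients of $e_{I,\tilde I}$ (maximal minors in columns $I\sqcup\tilde I$). For a noncrossing partition $\sigma$ of $[n]$, its Kreweras complement $\tilde\sigma$ is the unique noncrossing partition of $[\tilde n]$ such that $\sigma\sqcup\tilde\sigma$ is noncrossing on $[n]\sqcup[\tilde n]$ in the circular order $1,\tilde1,\dots,n,\tilde n$; $(I,\tilde I)$ is concordant with $(\sigma,\tilde\sigma)$ if $I$ meets each block of $\sigma$ in exactly one element and $\tilde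 I$ meets each block of $\tilde\sigma$ in exactly one element; $f_\sigma=\sum_{(I,\tilde I)\text{ concordant}}e_{I,\tilde I}$. A planar electrical network is a graph $G$ embedded in a disk with boundary vertices $1,\dots,n$ on the boundary circle, with positive edge conductances $c(e)$. A grove is a spanning acyclic subgraph $F$ each of whose components contains a boundary vertex; $w(F)=\prod_{e\in F}c(e)$; $\sigma(F)$ is the partition of $[n]$ by components of $F$; $\Lambda_\sigma(G)=\sum_{\sigma(F)=\sigma}w(F)$. (By earlier work of Lam, $[\sum_\sigma\Lambda_\sigma(G)f_\sigma]$ is the Plücker image of a point of $\mathrm{Gr}(n+1,2n)$.) The response matrix $L$ is the $n\times n$ matrix such that, for boundary voltages $(V_1,\dots,V_n)$ with harmonic extension $V$ (i.e. $\sum_{w\sim u}c(uw)(V(u)-V(w))=0$ at each interior vertex $u$), $(LV)_u=\sum_{w\sim u}c(uw)(V(w)-V(u))$ for each boundary vertex $u$; equivalently $L$ is minus the Schur complement of the graph Laplacian onto the boundary vertices. $\Omega$ is the skew form $\Omega(x,y)=\sum_{i=1}^n(x_iy_{\tilde i}-x_{\tilde i}y_i)+\sum_{j=1}^{n-1}(x_{j+1}y_{\tilde j}-x_{\tilde j}y_{j+1})+(-1)^n(x_1y_{\tilde n}-x_{\tilde n}y_1)$ on $V$; $U_{\text{not shorted}}$ is the set of $(n+1)$-dimensional $\Omega$-isotropic subspaces $X$ with $\Delta_{[n],\{\tilde k\}}(X)\neq0$ for all $k$. *)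

theory Defs
  imports
    "HOL-Library.Disjoint_Sets"
    "HOL-Analysis.Path_Connected"
    "Jordan_Normal_Form.VS_Connect"
    "Jordan_Normal_Form.DL_Submatrix"
begin

text \<open>
  All labels are shifted by one: \<open>[n]\<close> and the set of tilde labels are both \<open>{..<n}\<close>, and the
  ordered basis \<open>1 < 1~ < 2 < 2~ < ...\<close> of \<open>V = \<real>\<^sup>2\<^sup>n\<close> is enumerated by \<open>{..<2 * n}\<close>, with \<open>i\<close> at
  position \<open>2 * i\<close> and \<open>i~\<close> at position \<open>2 * i + 1\<close>.
\<close>

definition pos :: "nat \<Rightarrow> nat" where "pos i = 2 * i"

definition tpos :: "nat \<Rightarrow> nat" where "tpos i = 2 * i + 1"


subsection \<open>Noncrossing partitions\<close>

text \<open>The crossing condition is invariant under cyclic shifts, so the linear order can be used.\<close>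

definition noncrossing :: "nat set set \<Rightarrow> bool" where
  "noncrossing P \<longleftrightarrow>
     (\<forall>A\<in>P. \<forall>B\<in>P. A \<noteq> B \<longrightarrow>
        \<not> (\<exists>a b c d. a < b \<and> b < c \<and> c < d \<and> a \<in> A \<and> c \<in> A \<and> b \<in> B \<and> d \<in> B))"

definition nc_partition :: "nat \<Rightarrow> nat set set \<Rightarrow> bool" where
  "nc_partition n P \<longleftrightarrow> partition_on {..<n} P \<and> noncrossing P"

definition joint_partition :: "nat set set \<Rightarrow> nat set set \<Rightarrow> nat set set" where
  "joint_partition \<sigma> \<tau> = (\<lambda>B. pos ` B) ` \<sigma> \<union> (\<lambda>B. tpos ` B) ` \<tau>"

text \<open>The Kreweras complement is the coarsest partition of the tilde labels whose union with
  \<open>\<sigma>\<close> is noncrossing. (Coarsest is essential: every noncrossing refinement also has a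
  noncrossing union with \<open>\<sigma>\<close>.)\<close>

definition kreweras :: "nat \<Rightarrow> nat set set \<Rightarrow> nat set set" where
  "kreweras n \<sigma> =
     (THE \<tau>. nc_partition n \<tau> \<and> noncrossing (joint_partition \<sigma> \<tau>) \<and>
        (\<forall>\<tau>'. nc_partition n \<tau>' \<and> noncrossing (joint_partition \<sigma> \<tau>') \<longrightarrow> refines {..<n} \<tau>' \<tau>))"

definition concordant :: "nat set \<Rightarrow> nat set \<Rightarrow> nat set set \<Rightarrow> nat set set \<Rightarrow> bool" where
  "concordant I J \<sigma> \<tau> \<longleftrightarrow> (\<forall>B\<in>\<sigma>. card (I \<inter> B) = 1) \<and> (\<forall>B\<in>\<tau>. card (J \<inter> B) = 1)"

text \<open>Elements of the exterior power of degree \<open>n + 1\<close> are given by their coefficients at the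
  basis elements \<open>e\<^sub>I\<^sub>,\<^sub>J\<close>, where \<open>I, J \<subseteq> {..<n}\<close> and \<open>card I + card J = n + 1\<close> (the set \<open>J\<close>
  consists of tilde labels).\<close>

definition f_vec :: "nat \<Rightarrow> nat set set \<Rightarrow> nat set \<Rightarrow> nat set \<Rightarrow> real" where
  "f_vec n \<sigma> I J = (if concordant I J \<sigma> (kreweras n \<sigma>) then 1 else 0)"


subsection \<open>Planar electrical networks\<close>

text \<open>Multiple edges and loops are allowed; \<open>ends e\<close> is a singleton exactly when \<open>e\<close> is a loop.\<close>

record ('v, 'e) network =
  verts :: "'v set"
  edges :: "'e set"
  ends :: "'e \<Rightarrow> 'v set"
  cond :: "'e \<Rightarrow> real"
  bdry :: "nat \<Rightarrow> 'v"

definition electrical_network :: "nat \<Rightarrow> ('v, 'e) network \<Rightarrow> bool" where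
  "electrical_network n G \<longleftrightarrow>
     finite (verts G) \<and> finite (edges G) \<and>
     (\<forall>e\<in>edges G. \<exists>u\<in>verts G. \<exists>v\<in>verts G. ends G e = {u, v}) \<and>
     (\<forall>e\<in>edges G. cond G e > 0) \<and>
     bdry G ` {..<n} \<subseteq> verts G \<and> inj_on (bdry G) {..<n}"

text \<open>An embedding in the closed unit disk: \<open>p\<close> places the vertices and \<open>g\<close> draws the edges. The
  boundary vertices lie on the unit circle, numbered clockwise.\<close>

definition disk_embedding ::
  "nat \<Rightarrow> ('v, 'e) network \<Rightarrow> ('v \<Rightarrow> complex) \<Rightarrow> ('e \<Rightarrow> real \<Rightarrow> complex) \<Rightarrow> bool" where
  "disk_embedding n G p g \<longleftrightarrow>
     inj_on p (verts G) \<and>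
     (\<forall>v\<in>verts G - bdry G ` {..<n}. p v \<in> ball 0 1) \<and>
     (\<exists>\<theta>. strict_mono_on {..<n} \<theta> \<and> (\<forall>i<n. \<theta> i < \<theta> 0 + 2 * pi) \<and>
        (\<forall>i<n. p (bdry G i) = cis (- \<theta> i))) \<and>
     (\<forall>e\<in>edges G. simple_path (g e) \<and> path_image (g e) \<subseteq> cball 0 1 \<and>
        p ` ends G e = {pathstart (g e), pathfinish (g e)} \<and>
        path_image (g e) \<inter> p ` verts G = p ` ends G e) \<and>
     (\<forall>e\<in>edges G. \<forall>e'\<in>edges G. e \<noteq> e' \<longrightarrow>
        path_image (g e) \<inter> path_image (g e') \<subseteq> p ` verts G)"

definition planar_electrical_network :: "nat \<Rightarrow> ('v, 'e) network \<Rightarrow> bool" where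
  "planar_electrical_network n G \<longleftrightarrow>
     electrical_network n G \<and> (\<exists>p g. disk_embedding n G p g)"


subsection \<open>Groves\<close>

text \<open>A spanning subgraph is given by its set \<open>F\<close> of edges.\<close>

definition connected_by :: "('v, 'e) network \<Rightarrow> 'e set \<Rightarrow> ('v \<times> 'v) set" where
  "connected_by G F = {(u, v). \<exists>e\<in>F. ends G e = {u, v}}\<^sup>*"

text \<open>Loops are cycles of length one and pairs of parallel edges are cycles of length two.\<close>

definition is_cycle :: "('v, 'e) network \<Rightarrow> 'e set \<Rightarrow> 'v list \<Rightarrow> 'e list \<Rightarrow> bool" where
  "is_cycle G F vs es \<longleftrightarrow>
     es \<noteq> [] \<and> length vs = length es \<and> distinct vs \<and> distinct es \<and> set es \<subseteq> F \<and>
     (\<forall>i<length es. ends G (es ! i) = {vs ! i, vs ! ((i + 1) mod length es)})"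

definition grove :: "nat \<Rightarrow> ('v, 'e) network \<Rightarrow> 'e set \<Rightarrow> bool" where
  "grove n G F \<longleftrightarrow>
     F \<subseteq> edges G \<and> \<not> (\<exists>vs es. is_cycle G F vs es) \<and>
     (\<forall>v\<in>verts G. \<exists>i<n. (v, bdry G i) \<in> connected_by G F)"

definition grove_partition :: "nat \<Rightarrow> ('v, 'e) network \<Rightarrow> 'e set \<Rightarrow> nat set set" where
  "grove_partition n G F =
     {..<n} // {(i, j). i < n \<and> j < n \<and> (bdry G i, bdry G j) \<in> connected_by G F}"

definition grove_weight :: "('v, 'e) network \<Rightarrow> 'e set \<Rightarrow> real" where
  "grove_weight G F = (\<Prod>e\<in>F. cond G e)"

definition grove_measurement :: "nat \<Rightarrow> ('v, 'e) network \<Rightarrow> nat set set \<Rightarrow> real" where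
  "grove_measurement n G \<sigma> =
     (\<Sum>F\<in>{F. grove n G F \<and> grove_partition n G F = \<sigma>}. grove_weight G F)"

definition grove_vector :: "nat \<Rightarrow> ('v, 'e) network \<Rightarrow> nat set \<Rightarrow> nat set \<Rightarrow> real" where
  "grove_vector n G I J =
     (\<Sum>\<sigma>\<in>{\<sigma>. nc_partition n \<sigma>}. grove_measurement n G \<sigma> * f_vec n \<sigma> I J)"


subsection \<open>The response matrix\<close>

definition inflow :: "('v, 'e) network \<Rightarrow> ('v \<Rightarrow> real) \<Rightarrow> 'v \<Rightarrow> real" where
  "inflow G V u =
     (\<Sum>w\<in>verts G. \<Sum>e\<in>{e \<in> edges G. ends G e = {u, w}}. cond G e * (V w - V u))"

definition harmonic_inside :: "nat \<Rightarrow> ('v, 'e) network \<Rightarrow> ('v \<Rightarrow> real) \<Rightarrow> bool" where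
  "harmonic_inside n G V \<longleftrightarrow> (\<forall>u\<in>verts G - bdry G ` {..<n}. inflow G V u = 0)"

definition is_response_matrix :: "nat \<Rightarrow> ('v, 'e) network \<Rightarrow> real mat \<Rightarrow> bool" where
  "is_response_matrix n G L \<longleftrightarrow>
     L \<in> carrier_mat n n \<and>
     (\<forall>V. harmonic_inside n G V \<longrightarrow>
        L *\<^sub>v Matrix.vec n (\<lambda>i. V (bdry G i)) = Matrix.vec n (\<lambda>i. inflow G V (bdry G i)))"


subsection \<open>The Grassmannian\<close>

definition Gr :: "nat \<Rightarrow> nat \<Rightarrow> real Matrix.vec set set" where
  "Gr k m = {X. VectorSpace.subspace class_ring X (module_vec TYPE(real) m) \<and>
     vectorspace.dim class_ring ((module_vec TYPE(real) m)\<lparr>carrier := X\<rparr>) = k}"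

abbreviation row_span :: "nat \<Rightarrow> real mat \<Rightarrow> real Matrix.vec set" where
  "row_span m B \<equiv> vec_space.row_space m B"

definition minor :: "real mat \<Rightarrow> nat set \<Rightarrow> nat set \<Rightarrow> real" where
  "minor B I J = Determinant.det (submatrix B UNIV (pos ` I \<union> tpos ` J))"

text \<open>\<open>X\<close> is a point of \<open>Gr(n + 1, 2 n)\<close> with vector of Plucker coordinates \<open>p\<close>, where \<open>p\<close> is
  determined by \<open>X\<close> up to a nonzero scalar.\<close>

definition has_plucker_vector ::
  "nat \<Rightarrow> real Matrix.vec set \<Rightarrow> (nat set \<Rightarrow> nat set \<Rightarrow> real) \<Rightarrow> bool" where
  "has_plucker_vector n X p \<longleftrightarrow>
     X \<in> Gr (n + 1) (2 * n) \<and>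
     (\<exists>B\<in>carrier_mat (n + 1) (2 * n). row_span (2 * n) B = X \<and>
        (\<exists>c. c \<noteq> 0 \<and>
           (\<forall>I J. I \<subseteq> {..<n} \<and> J \<subseteq> {..<n} \<and> card I + card J = n + 1 \<longrightarrow>
              p I J = c * minor B I J)))"

definition Omega :: "nat \<Rightarrow> real Matrix.vec \<Rightarrow> real Matrix.vec \<Rightarrow> real" where
  "Omega n x y =
     (\<Sum>i<n. vec_index x (pos i) * vec_index y (tpos i)
            - vec_index x (tpos i) * vec_index y (pos i))
   + (\<Sum>j<n - 1. vec_index x (pos (j + 1)) * vec_index y (tpos j)
            - vec_index x (tpos j) * vec_index y (pos (j + 1)))
   + (- 1) ^ n * (vec_index x (pos 0) * vec_index y (tpos (n - 1))
            - vec_index x (tpos (n - 1)) * vec_index y (pos 0))"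

text \<open>Vanishing of a Plucker coordinate does not depend on the matrix chosen to represent \<open>X\<close>.\<close>

definition U_not_shorted :: "nat \<Rightarrow> real Matrix.vec set set" where
  "U_not_shorted n =
     {X \<in> Gr (n + 1) (2 * n).
        (\<forall>x\<in>X. \<forall>y\<in>X. Omega n x y = 0) \<and>
        (\<forall>B\<in>carrier_mat (n + 1) (2 * n). row_span (2 * n) B = X \<longrightarrow>
           (\<forall>k<n. minor B {..<n} {k} \<noteq> 0))}"


subsection \<open>The matrices M, D and P\<close>

definition M_mat :: "nat \<Rightarrow> real mat \<Rightarrow> real mat" where
  "M_mat n S = Matrix.mat (n + 1) (2 * n) (\<lambda>(r, c).
     if r = 0 then (if even c then 0 else 1)
     else (if even c then (if c = pos (r - 1) then 1 else 0) else S $$ (r - 1, c div 2)))"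

definition D_mat :: "nat \<Rightarrow> real mat" where
  "D_mat n = mat_diag (2 * n) (\<lambda>c. (- 1) ^ (c div 2))"

definition P_mat :: "nat \<Rightarrow> real mat \<Rightarrow> real mat" where
  "P_mat n S = Matrix.mat n n (\<lambda>(a, b). S $$ (b, (a + n - 1) mod n) - S $$ (b, a))"

end

theory Submission
  imports Defs "Jordan_Normal_Form.DL_Rank"
begin

text \<open>
  The row of \<open>M D\<close> belonging to \<open>i\<close> is, up to a scalar, the vector of Plucker coordinates
  \<open>\<Delta>\<^bsub>T \<union> {c}\<^esub>\<close> for \<open>T = [n] - {i} \<union> {n~}\<close>, which lies in \<open>X\<close> by Laplace expansion. A partition
  concordant with \<open>[n] - {i}\<close> has a single pair \<open>{i, j}\<close> and otherwise singletons, and its Kreweras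
  complement is \<open>[i, j)\<close> together with the complement of \<open>[i, j)\<close>. So the only grove measurements
  that occur are those of the partition into singletons, \<open>\<Lambda>\<^sub>1\<close>, and of the pairs, \<open>\<Lambda>\<^bsub>ij\<^esub>\<close>. For the
  response matrix,
  \<open>\<Lambda>\<^bsub>ij\<^esub> = L\<^bsub>ij\<^esub> \<Lambda>\<^sub>1\<close>: the total weight of the rooted groves that link \<open>u\<close> to \<open>j\<close> is a potential in \<open>u\<close>,
  harmonic inside and zero at the boundary vertices other than \<open>j\<close>, because adding an edge \<open>uw\<close> to a
  rooted grove with \<open>u\<close> linked to \<open>i\<close> and \<open>w\<close> to \<open>j\<close> gives a grove whose path from \<open>i\<close> to \<open>j\<close> passes
  through \<open>u\<close>. Hence \<open>S\<^bsub>ik\<^esub> = \<Sum>\<^bsub>j > k\<^esub> L\<^bsub>ij\<^esub>\<close>, and the differences of adjacent columns of \<open>S\<close> give back \<open>L\<close>.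
\<close>

section \<open>Connectivity and forests\<close>

lemma connected_by_refl [simp]: "(u, u) \<in> connected_by G F"
  by (simp add: connected_by_def)

lemma connected_by_trans:
  "(u, v) \<in> connected_by G F \<Longrightarrow> (v, w) \<in> connected_by G F \<Longrightarrow> (u, w) \<in> connected_by G F"
  unfolding connected_by_def by (rule rtrancl_trans)

lemma connected_by_sym: "(u, v) \<in> connected_by G F \<Longrightarrow> (v, u) \<in> connected_by G F"
  unfolding connected_by_def
  by (rule symD[OF sym_rtrancl]) (auto simp: sym_def insert_commute)

lemma connected_by_mono: "(u, v) \<in> connected_by G F \<Longrightarrow> F \<subseteq> H \<Longrightarrow> (u, v) \<in> connected_by G H"
  unfolding connected_by_def by (erule subsetD[OF rtrancl_mono, rotated]) auto

lemma connected_by_edge: "e \<in> F \<Longrightarrow> ends G e = {u, w} \<Longrightarrow> (u, w) \<in> connected_by G F"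
  unfolding connected_by_def by (rule r_into_rtrancl) auto

text \<open>A walk can be shortened to cross the new edge at most once, in one of its two
  directions. Questions about adding or deleting one edge are thereby reduced to the smaller edge
  set.\<close>

lemma connected_by_insert:
  assumes e: "ends G e = {u, w}"
  shows "(x, y) \<in> connected_by G (insert e F) \<longleftrightarrow>
    (x, y) \<in> connected_by G F \<or>
    (x, u) \<in> connected_by G F \<and> (w, y) \<in> connected_by G F \<or>
    (x, w) \<in> connected_by G F \<and> (u, y) \<in> connected_by G F" (is "?L \<longleftrightarrow> ?R y")
proof
  assume ?L
  then have "(x, y) \<in> {(u, v). \<exists>e'\<in>insert e F. ends G e' = {u, v}}\<^sup>*"
    by (simp add: connected_by_def)
  then show "?R y"
  proof (induction rule: rtrancl_induct)
    case base
    then show ?case by simp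
  next
    case (step y z)
    then obtain e' where e': "e' \<in> insert e F" "ends G e' = {y, z}" by blast
    show ?case
    proof (cases "e' = e")
      case True
      then have "y = u \<and> z = w \<or> y = w \<and> z = u" using e e' by (auto simp: doubleton_eq_iff)
      then show ?thesis using step.IH by auto
    next
      case False
      then have "(y, z) \<in> connected_by G F" using e' connected_by_edge by fastforce
      then show ?thesis using step.IH connected_by_trans by metis
    qed
  qed
next
  have uw: "(u, w) \<in> connected_by G (insert e F)" using e by (intro connected_by_edge) auto
  note wu = connected_by_sym[OF uw]
  have m: "(a, b) \<in> connected_by G (insert e F)" if "(a, b) \<in> connected_by G F" for a b
    using that by (rule connected_by_mono) auto
  assume "?R y"
  then show ?L
    using m connected_by_trans[OF connected_by_trans[OF m uw] m]
      connected_by_trans[OF connected_by_trans[OF m wu] m] by blast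
qed

text \<open>Acyclicity in the form that every edge is a bridge, which suits adding and deleting
  single edges. A loop violates it because \<open>connected_by\<close> is reflexive.\<close>

definition forest :: "('v, 'e) network \<Rightarrow> 'e set \<Rightarrow> bool" where
  "forest G F \<longleftrightarrow> (\<forall>e\<in>F. \<forall>u w. ends G e = {u, w} \<longrightarrow> (u, w) \<notin> connected_by G (F - {e}))"

text \<open>In a walk of least length no vertex repeats, since a repetition could be cut out. The
  edges are then distinct because the starting vertex of an earlier step is not an end of a later
  edge.\<close>

lemma connected_by_simple_path:
  assumes "(u, w) \<in> connected_by G F"
  obtains m p es where "p 0 = u" "p m = w" "inj_on p {..m}" "length es = m" "distinct es"
    "set es \<subseteq> F" "\<forall>i<m. ends G (es ! i) = {p i, p (Suc i)}"
proof -
  define R where "R = {(u, v). \<exists>e\<in>F. ends G e = {u, v}}"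
  define m where "m = (LEAST m. (u, w) \<in> R ^^ m)"
  have ex: "\<exists>m. (u, w) \<in> R ^^ m"
    using assms by (simp add: connected_by_def R_def rtrancl_power)
  then have "(u, w) \<in> R ^^ m" unfolding m_def by (rule LeastI_ex)
  then obtain p where p: "p 0 = u" "p m = w" "\<And>i. i < m \<Longrightarrow> (p i, p (Suc i)) \<in> R"
    by (auto simp: relpow_fun_conv)
  have pow: "(p a, p b) \<in> R ^^ (b - a)" if "a \<le> b" "b \<le> m" for a b
    unfolding relpow_fun_conv using that p(3) by (intro exI[of _ "\<lambda>i. p (a + i)"]) auto
  have neq: "p a \<noteq> p b" if "a < b" "b \<le> m" for a b
  proof
    assume eq: "p a = p b"
    have "(u, w) \<in> R ^^ a O R ^^ (m - b)"
      using pow[of 0 a] pow[of b m] that eq p(1,2) by (auto intro: relcompI)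
    then have "(u, w) \<in> R ^^ (a + (m - b))" by (simp add: relpow_add)
    then have "m \<le> a + (m - b)" unfolding m_def by (rule Least_le)
    then show False using that by simp
  qed
  have inj: "inj_on p {..m}"
    by (rule linorder_inj_onI) (use neq in auto)
  define f where "f i = (SOME e. e \<in> F \<and> ends G e = {p i, p (Suc i)})" for i
  have f: "f i \<in> F \<and> ends G (f i) = {p i, p (Suc i)}" if "i < m" for i
    unfolding f_def by (rule someI_ex) (use p(3)[OF that] in \<open>auto simp: R_def\<close>)
  have "inj_on f {..<m}"
  proof (rule linorder_inj_onI)
    fix a b assume ab: "a < b" "a \<in> {..<m}" "b \<in> {..<m}"
    have "p a \<noteq> p b" "p a \<noteq> p (Suc b)" using ab neq by auto
    then have "{p a, p (Suc a)} \<noteq> {p b, p (Suc b)}" by (auto simp: doubleton_eq_iff)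
    then show "f a \<noteq> f b" using f[of a] f[of b] ab by auto
  qed auto
  then show thesis
    using f p(1,2) inj by (intro that[of p m "map f [0..<m]"]) (auto simp: distinct_map atLeast0LessThan)
qed

text \<open>The last edge of a cycle is bypassed by the other edges; conversely, a simple path that
  bypasses an edge closes up with it to a cycle.\<close>

lemma forest_iff_no_cycle: "forest G F \<longleftrightarrow> \<not> (\<exists>vs es. is_cycle G F vs es)"
proof (rule iffI; rule ccontr)
  assume F: "forest G F" and "\<not> \<not> (\<exists>vs es. is_cycle G F vs es)"
  then obtain vs es where c: "is_cycle G F vs es" by blast
  define m where "m = length es - 1"
  have len: "length es = Suc m" "length vs = Suc m" and es: "distinct es" "set es \<subseteq> F"
    and ends: "\<And>i. i < Suc m \<Longrightarrow> ends G (es ! i) = {vs ! i, vs ! (Suc i mod Suc m)}"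
    using c by (auto simp: is_cycle_def m_def)
  have "(vs ! 0, vs ! i) \<in> connected_by G (F - {es ! m})" if "i \<le> m" for i
    using that
  proof (induction i)
    case (Suc i)
    have "es ! i \<noteq> es ! m" using es(1) len Suc.prems by (auto simp: nth_eq_iff_index_eq)
    moreover have "es ! i \<in> F" using es(2) len Suc.prems nth_mem[of i es] by auto
    ultimately have "(vs ! i, vs ! Suc i) \<in> connected_by G (F - {es ! m})"
      using ends[of i] Suc.prems by (intro connected_by_edge[of "es ! i"]) auto
    then show ?case using Suc connected_by_trans by (metis Suc_leD)
  qed simp
  from connected_by_sym[OF this[OF order_refl]]
  have "(vs ! m, vs ! 0) \<in> connected_by G (F - {es ! m})" .
  moreover have "es ! m \<in> F" using es(2) len nth_mem[of m es] by auto
  ultimately show False using F ends[of m] by (auto simp: forest_def)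
next
  assume nc: "\<not> (\<exists>vs es. is_cycle G F vs es)"
  assume "\<not> forest G F"
  then obtain e u w where e: "e \<in> F" "ends G e = {u, w}" "(u, w) \<in> connected_by G (F - {e})"
    by (auto simp: forest_def)
  obtain m p es where p: "p 0 = u" "p m = w" "inj_on p {..m}" "length es = m" "distinct es"
    "set es \<subseteq> F - {e}" "\<forall>i<m. ends G (es ! i) = {p i, p (Suc i)}"
    by (rule connected_by_simple_path[OF e(3)])
  \<comment> \<open>For \<open>m = 0\<close> this cycle is a loop, for \<open>m = 1\<close> a pair
    of parallel edges.\<close>
  have "is_cycle G F (map p [0..<Suc m]) (es @ [e])"
    unfolding is_cycle_def
  proof (intro conjI allI impI)
    show "distinct (map p [0..<Suc m])"
      using p(3) by (simp add: distinct_map atLeast0LessThan lessThan_Suc_atMost del: upt_Suc)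
    fix i assume "i < length (es @ [e])"
    then consider "i < m" | "i = m" using p(4) by fastforce
    then show "ends G ((es @ [e]) ! i) =
      {map p [0..<Suc m] ! i, map p [0..<Suc m] ! ((i + 1) mod length (es @ [e]))}"
      using p e(2) by cases (auto simp: nth_append simp del: upt_Suc)
  qed (use p e(1) in \<open>auto simp del: upt_Suc\<close>)
  then show False using nc by blast
qed

lemma forest_subset: "forest G F \<Longrightarrow> H \<subseteq> F \<Longrightarrow> forest G H"
  unfolding forest_def by (meson Diff_mono connected_by_mono order_refl subsetD)

text \<open>If an old edge \<open>f\<close> were no longer a bridge, its ends would be joined by a
  walk through \<open>e\<close>; together with \<open>f\<close> the rest of that walk would already
  join \<open>u\<close> and \<open>w\<close> in \<open>F\<close>.\<close>

lemma forest_insert: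
  assumes F: "forest G F" and e: "ends G e = {u, w}" and uw: "(u, w) \<notin> connected_by G F"
  shows "forest G (insert e F)"
  unfolding forest_def
proof (intro ballI allI impI notI)
  fix f x y
  assume f: "f \<in> insert e F" "ends G f = {x, y}" and c: "(x, y) \<in> connected_by G (insert e F - {f})"
  have "e \<notin> F" using uw e connected_by_edge by metis
  show False
  proof (cases "f = e")
    case True
    then have "(x, y) \<in> connected_by G F" using c \<open>e \<notin> F\<close> by simp
    moreover have "{x, y} = {u, w}" using True f(2) e by simp
    ultimately show False using uw connected_by_sym by (metis doubleton_eq_iff)
  next
    case False
    then have "f \<in> F" using f by simp
    then have nxy: "(x, y) \<notin> connected_by G (F - {f})" using F f(2) by (auto simp: forest_def)
    have "insert e F - {f} = insert e (F - {f})" using False by auto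
    with c have "(x, y) \<in> connected_by G (insert e (F - {f}))" by simp
    then have "(x, u) \<in> connected_by G (F - {f}) \<and> (w, y) \<in> connected_by G (F - {f}) \<or>
      (x, w) \<in> connected_by G (F - {f}) \<and> (u, y) \<in> connected_by G (F - {f})"
      using nxy unfolding connected_by_insert[OF e] by blast
    then have "(x, u) \<in> connected_by G F \<and> (w, y) \<in> connected_by G F \<or>
      (x, w) \<in> connected_by G F \<and> (u, y) \<in> connected_by G F"
      using connected_by_mono[of _ _ G "F - {f}" F] by blast
    moreover have "(x, y) \<in> connected_by G F" using f(2) \<open>f \<in> F\<close> connected_by_edge by metis
    ultimately show False using uw connected_by_sym connected_by_trans by metis
  qed
qed

text \<open>Take the edge by which a walk to \<open>x\<close> leaves \<open>u\<close> for the last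
  time; the rest of the walk uses no edge at \<open>u\<close>.\<close>

lemma first_edge_exists:
  assumes c: "(u, x) \<in> connected_by G F" and "u \<noteq> x"
  obtains e w where "e \<in> F" "ends G e = {u, w}" "(w, x) \<in> connected_by G (F - {e})"
proof -
  \<comment> \<open>No edge at \<open>u\<close> belongs to \<open>H\<close>, so \<open>u\<close> is
    isolated there, and a link within \<open>H\<close> survives the deletion of whichever edge
    leaves \<open>u\<close>.\<close>
  define H where "H = {e \<in> F. u \<notin> ends G e}"
  have isolated: "z = u" if "(u, z) \<in> connected_by G H" for z
    using that unfolding connected_by_def by (induction rule: rtrancl_induct) (auto simp: H_def)
  let ?E = "\<exists>e\<in>F. \<exists>w. ends G e = {u, w} \<and> (w, x) \<in> connected_by G H"
  have "(y, x) \<in> connected_by G H \<or> ?E"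
    if "(y, x) \<in> {(u, v). \<exists>e\<in>F. ends G e = {u, v}}\<^sup>*" for y
    using that
  proof (induction rule: converse_rtrancl_induct)
    case (step y z)
    then obtain f where f: "f \<in> F" "ends G f = {y, z}" by blast
    consider "?E" | "(z, x) \<in> connected_by G H" using step.IH by blast
    then show ?case
    proof cases
      case 2
      then have "z \<noteq> u" using isolated[of x] \<open>u \<noteq> x\<close> by blast
      show ?thesis
      proof (cases "y = u")
        case True
        then show ?thesis using 2 f by blast
      next
        case False
        then have "f \<in> H" using f \<open>z \<noteq> u\<close> by (auto simp: H_def)
        then show ?thesis using 2 f(2) connected_by_edge connected_by_trans by metis
      qed
    qed blast
  qed simp
  then have ?E using c isolated[of x] \<open>u \<noteq> x\<close> unfolding connected_by_def[of G F] by blast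
  then obtain e w where e: "e \<in> F" "ends G e = {u, w}" "(w, x) \<in> connected_by G H" by blast
  have "H \<subseteq> F - {e}" using e(2) by (auto simp: H_def)
  then show thesis using that[OF e(1,2)] e(3) connected_by_mono by metis
qed

text \<open>Two different edges would give two routes from \<open>u\<close> to \<open>x\<close>, and
  then one of them would not be a bridge.\<close>

lemma first_edge_unique:
  assumes F: "forest G F"
    and e: "e \<in> F" "ends G e = {u, w}" "(w, x) \<in> connected_by G (F - {e})"
    and e': "e' \<in> F" "ends G e' = {u, w'}" "(w', x) \<in> connected_by G (F - {e'})"
  shows "e = e'"
proof (rule ccontr)
  assume neq: "e \<noteq> e'"
  have br: "(u, w) \<notin> connected_by G (F - {e})" "(u, w') \<notin> connected_by G (F - {e'})"
    using F e e' by (auto simp: forest_def)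
  then have ux: "(u, x) \<notin> connected_by G (F - {e})"
    using e(3) connected_by_sym connected_by_trans by metis
  let ?K = "F - {e} - {e'}"
  have K: "(a, b) \<in> connected_by G (F - {e}) \<and> (a, b) \<in> connected_by G (F - {e'})"
    if "(a, b) \<in> connected_by G ?K" for a b
    using that connected_by_mono[of a b G ?K] by blast
  have "F - {e'} = insert e ?K" using neq e(1) by auto
  then have "(w', x) \<in> connected_by G (insert e ?K)" using e'(3) by simp
  then consider "(w', x) \<in> connected_by G ?K" | "(w', u) \<in> connected_by G ?K"
    | "(u, x) \<in> connected_by G ?K"
    unfolding connected_by_insert[OF e(2)] by blast
  then show False
  proof cases
    case 1
    have "(u, w') \<in> connected_by G (F - {e})"
      using e' neq by (intro connected_by_edge[of e']) auto
    then show False using K[OF 1] ux connected_by_trans by metis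
  next
    case 2
    then show False using K connected_by_sym br by metis
  next
    case 3
    then show False using K ux by blast
  qed
qed

section \<open>Groves and the response matrix\<close>

text \<open>For \<open>i = j\<close> this is the partition into singletons, written
  \<open>pair_partition n 0 0\<close> below. The quotient form matches
  \<open>grove_partition\<close>, so comparing partitions amounts to comparing relations.\<close>

definition pair_partition :: "nat \<Rightarrow> nat \<Rightarrow> nat \<Rightarrow> nat set set" where
  "pair_partition n i j = {..<n} // {(k, l). k < n \<and> l < n \<and> (k = l \<or> {k, l} = {i, j})}"

definition linked_groves :: "nat \<Rightarrow> ('v, 'e) network \<Rightarrow> nat \<Rightarrow> nat \<Rightarrow> 'e set set" where
  "linked_groves n G i j =
     {F. F \<subseteq> edges G \<and> forest G F \<and>
         (\<forall>v\<in>verts G. \<exists>k<n. (v, bdry G k) \<in> connected_by G F) \<and>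
         (\<forall>k<n. \<forall>l<n. (bdry G k, bdry G l) \<in> connected_by G F \<longleftrightarrow> k = l \<or> {k, l} = {i, j})}"

text \<open>On the diagonal the permitted link is trivial: every component contains exactly one
  boundary vertex, its root.\<close>

abbreviation rooted_groves :: "nat \<Rightarrow> ('v, 'e) network \<Rightarrow> 'e set set" where
  "rooted_groves n G \<equiv> linked_groves n G 0 0"

lemma quotient_eq_iff:
  assumes "equiv A r" "equiv A s"
  shows "A // r = A // s \<longleftrightarrow> r = s"
proof
  have *: "r = {(x, y). \<exists>B\<in>A // r. x \<in> B \<and> y \<in> B}" if "equiv A r" for r
  proof (intro equalityI subrelI)
    fix x y assume xy: "(x, y) \<in> r"
    then have "x \<in> A" using equiv_type[OF that] by blast
    then have "r `` {x} \<in> A // r" "x \<in> r `` {x}" "y \<in> r `` {x}"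
      using equiv_class_self[OF that] xy by (auto intro: quotientI)
    then show "(x, y) \<in> {(x, y). \<exists>B\<in>A // r. x \<in> B \<and> y \<in> B}" by blast
  qed (use in_quotient_imp_in_rel[OF that] in blast)
  show "r = s" if "A // r = A // s"
    using *[OF assms(1)] *[OF assms(2)] that by simp
qed simp

lemma equiv_pair: "equiv {..<n} {(k, l). k < n \<and> l < n \<and> (k = l \<or> {k, l} = {i, j})}"
  (is "equiv _ ?R")
proof (rule equivI)
  show "sym ?R" by (auto simp: sym_def insert_commute)
  show "trans ?R" by (rule transI) (auto simp: doubleton_eq_iff)
qed (auto simp: refl_on_def)

lemma grove_measurement_pair:
  "grove_measurement n G (pair_partition n i j) = (\<Sum>F\<in>linked_groves n G i j. grove_weight G F)"
proof -
  have "equiv {..<n} {(k, l). k < n \<and> l < n \<and> (bdry G k, bdry G l) \<in> connected_by G F}"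
    (is "equiv _ ?R") for F
  proof (rule equivI)
    show "sym ?R" by (auto simp: sym_def connected_by_sym)
    show "trans ?R" unfolding trans_def using connected_by_trans by fast
  qed (auto simp: refl_on_def)
  note eq = quotient_eq_iff[OF this equiv_pair]
  have coll: "{(k, l). k < n \<and> l < n \<and> P k l} = {(k, l). k < n \<and> l < n \<and> Q k l} \<longleftrightarrow>
    (\<forall>k<n. \<forall>l<n. P k l \<longleftrightarrow> Q k l)" for P Q :: "nat \<Rightarrow> nat \<Rightarrow> bool"
    by blast
  have "grove_partition n G F = pair_partition n i j \<longleftrightarrow>
      (\<forall>k<n. \<forall>l<n. (bdry G k, bdry G l) \<in> connected_by G F \<longleftrightarrow> k = l \<or> {k, l} = {i, j})" for F
    unfolding grove_partition_def pair_partition_def eq by (rule coll)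
  then have "{F. grove n G F \<and> grove_partition n G F = pair_partition n i j} = linked_groves n G i j"
    by (simp add: linked_groves_def grove_def forest_iff_no_cycle conj_assoc)
  then show ?thesis by (simp add: grove_measurement_def)
qed

lemma rooted_groves_iff:
  "F \<in> rooted_groves n G \<longleftrightarrow> F \<subseteq> edges G \<and> forest G F \<and>
     (\<forall>v\<in>verts G. \<exists>k<n. (v, bdry G k) \<in> connected_by G F) \<and>
     (\<forall>k<n. \<forall>l<n. (bdry G k, bdry G l) \<in> connected_by G F \<longrightarrow> k = l)"
  by (auto simp: linked_groves_def doubleton_eq_iff)

lemma linked_groves_commute: "linked_groves n G i j = linked_groves n G j i"
  by (simp add: linked_groves_def insert_commute)

context
  fixes n :: nat and G :: "('v, 'e) network"
  assumes net: "electrical_network n G"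
begin

section \<open>Joining and cutting the trees of a rooted grove\<close>

lemma finite_linked_groves [simp]: "finite (linked_groves n G i j)"
  by (rule finite_subset[of _ "Pow (edges G)"])
    (use net in \<open>auto simp: linked_groves_def electrical_network_def\<close>)

lemma finite_grove: "F \<in> linked_groves n G i j \<Longrightarrow> finite F"
  using net by (auto simp: linked_groves_def electrical_network_def intro: finite_subset)

lemma edge_ends_in_verts: "e \<in> edges G \<Longrightarrow> ends G e = {u, w} \<Longrightarrow> u \<in> verts G \<and> w \<in> verts G"
  using net unfolding electrical_network_def by (metis doubleton_eq_iff)

lemma bdry_in_verts: "k < n \<Longrightarrow> bdry G k \<in> verts G"
  using net by (auto simp: electrical_network_def)

lemma rooted_grove_root_unique:
  assumes F: "F \<in> rooted_groves n G" and k: "k < n" "l < n"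
    and c: "(v, bdry G k) \<in> connected_by G F" "(v, bdry G l) \<in> connected_by G F"
  shows "k = l"
  using F k connected_by_trans[OF connected_by_sym[OF c(1)] c(2)] by (simp add: rooted_groves_iff)

text \<open>The edge \<open>e\<close> joins two trees with different roots, so it closes no cycle
  and merges only the classes of \<open>i\<close> and \<open>j\<close>.\<close>

lemma insert_edge_linked:
  assumes F: "F \<in> rooted_groves n G" and e: "e \<in> edges G" "ends G e = {u, w}"
    and ij: "i < n" "j < n" "i \<noteq> j"
    and u: "(u, bdry G i) \<in> connected_by G F" and w: "(w, bdry G j) \<in> connected_by G F"
  shows "insert e F \<in> linked_groves n G i j" "e \<notin> F"
proof -
  note F' = F[unfolded rooted_groves_iff]
  have uw: "(u, w) \<notin> connected_by G F"
  proof
    assume "(u, w) \<in> connected_by G F"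
    then have "(u, bdry G j) \<in> connected_by G F" using w connected_by_trans by metis
    then show False using rooted_grove_root_unique[OF F ij(1,2) u] ij(3) by simp
  qed
  then show "e \<notin> F" using connected_by_edge e(2) by metis
  have root: "(bdry G k, u) \<in> connected_by G F \<longleftrightarrow> k = i"
    "(u, bdry G k) \<in> connected_by G F \<longleftrightarrow> k = i"
    "(bdry G k, w) \<in> connected_by G F \<longleftrightarrow> k = j"
    "(w, bdry G k) \<in> connected_by G F \<longleftrightarrow> k = j" if "k < n" for k
    using rooted_grove_root_unique[OF F that] ij u w connected_by_sym by metis+
  have "(bdry G k, bdry G l) \<in> connected_by G (insert e F) \<longleftrightarrow> k = l \<or> {k, l} = {i, j}"
    if "k < n" "l < n" for k l
    using F' that root[OF that(1)] root[OF that(2)] unfolding connected_by_insert[OF e(2)]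
    by (auto simp: doubleton_eq_iff)
  moreover have "\<exists>k<n. (v, bdry G k) \<in> connected_by G (insert e F)" if "v \<in> verts G" for v
    using F' that connected_by_mono[of _ _ G F "insert e F"] by blast
  ultimately show "insert e F \<in> linked_groves n G i j"
    using F' e uw forest_insert by (auto simp: linked_groves_def)
qed

text \<open>Cutting \<open>e\<close> leaves each half of its tree with a root of its own. The only
  link between distinct boundary vertices was that of \<open>i\<close> and \<open>j\<close>, and it
  is lost because \<open>e\<close> is a bridge.\<close>

lemma remove_edge_rooted:
  assumes H: "H \<in> linked_groves n G i j" and e: "e \<in> H" "ends G e = {u, w}"
    and ij: "i < n" "j < n"
    and u: "(u, bdry G i) \<in> connected_by G (H - {e})"
    and w: "(w, bdry G j) \<in> connected_by G (H - {e})"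
  shows "H - {e} \<in> rooted_groves n G"
proof -
  note H' = H[unfolded linked_groves_def mem_Collect_eq]
  have uw: "(u, w) \<notin> connected_by G (H - {e})" using H' e by (auto simp: forest_def)
  have He: "insert e (H - {e}) = H" using e by auto
  have "\<exists>k<n. (v, bdry G k) \<in> connected_by G (H - {e})" if "v \<in> verts G" for v
  proof -
    obtain k where k: "k < n" "(v, bdry G k) \<in> connected_by G (insert e (H - {e}))"
      using H' \<open>v \<in> verts G\<close> He by auto
    then show ?thesis
      using u w ij connected_by_trans unfolding connected_by_insert[OF e(2)] by metis
  qed
  moreover have "k = l"
    if kl: "k < n" "l < n" and c: "(bdry G k, bdry G l) \<in> connected_by G (H - {e})" for k l
  proof (rule ccontr)
    assume "k \<noteq> l"
    have "(bdry G k, bdry G l) \<in> connected_by G H" using c by (rule connected_by_mono) auto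
    then have "{k, l} = {i, j}" using H' kl \<open>k \<noteq> l\<close> by blast
    then have "(bdry G i, bdry G j) \<in> connected_by G (H - {e})"
      using c connected_by_sym by (metis doubleton_eq_iff)
    then show False
      using uw u connected_by_sym[OF w] connected_by_trans by metis
  qed
  ultimately show ?thesis
    using H' forest_subset[of G H "H - {e}"] by (auto simp: rooted_groves_iff)
qed

text \<open>Adding the edge \<open>e = uw\<close> to a rooted grove that links \<open>u\<close> to \<open>i\<close> and \<open>w\<close> to \<open>j\<close> gives a
  grove in which the path from \<open>i\<close> to \<open>j\<close> passes through \<open>u\<close> and leaves \<open>u\<close> along \<open>e\<close>, so that
  \<open>e\<close> can be recovered.\<close>

definition through_groves :: "nat \<Rightarrow> nat \<Rightarrow> 'v \<Rightarrow> 'e set set" where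
  "through_groves i j u = {H \<in> linked_groves n G i j. \<exists>e\<in>H. \<exists>w. ends G e = {u, w} \<and>
     (u, bdry G i) \<in> connected_by G (H - {e}) \<and> (w, bdry G j) \<in> connected_by G (H - {e})}"

text \<open>The map \<open>(w, e, F)\<close> to \<open>insert e F\<close> is a bijection from the
  index triples onto the groves on the right, and the summand is the weight of the image. This
  converts currents along the edges at \<open>u\<close> into grove weights.\<close>

lemma through_groves_sum:
  assumes ij: "i < n" "j < n" "i \<noteq> j"
  shows "(\<Sum>w\<in>verts G. \<Sum>e\<in>{e \<in> edges G. ends G e = {u, w}}.
      \<Sum>F\<in>{F \<in> rooted_groves n G.
        (u, bdry G i) \<in> connected_by G F \<and> (w, bdry G j) \<in> connected_by G F}.
        cond G e * grove_weight G F) = (\<Sum>H\<in>through_groves i j u. grove_weight G H)"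
proof -
  let ?E = "\<lambda>w. {e \<in> edges G. ends G e = {u, w}}"
  let ?F = "\<lambda>w. {F \<in> rooted_groves n G.
    (u, bdry G i) \<in> connected_by G F \<and> (w, bdry G j) \<in> connected_by G F}"
  let ?T = "SIGMA w:verts G. ?E w \<times> ?F w"
  let ?h = "\<lambda>(w, e, F). insert e F"
  have fin: "finite (verts G)" "finite (edges G)" using net by (auto simp: electrical_network_def)
  have ins: "insert e F \<in> linked_groves n G i j \<and> e \<notin> F" if "(w, e, F) \<in> ?T" for w e F
    using that insert_edge_linked[of F e u w i j] ij by auto
  have "bij_betw ?h ?T (through_groves i j u)"
  proof (rule bij_betw_imageI)
    show "inj_on ?h ?T"
    proof (rule inj_onI)
      fix x y assume xy: "x \<in> ?T" "y \<in> ?T" "?h x = ?h y"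
      obtain w e F w' e' F' where eq: "x = (w, e, F)" "y = (w', e', F')" by (metis prod_cases3)
      have x: "insert e F - {e} = F" "forest G (insert e F)"
        and y: "insert e' F' - {e'} = F'" and h: "insert e F = insert e' F'"
        using ins[of w e F] ins[of w' e' F'] xy eq by (auto simp: linked_groves_def)
      \<comment> \<open>Both edges begin the path from \<open>u\<close> to the boundary vertex
        \<open>j\<close> in the same forest.\<close>
      have e: "e = e'"
        by (rule first_edge_unique[OF x(2), of e u w "bdry G j" e' w'])
          (use xy(1,2) eq x(1) y h in auto)
      have "F = F'" using x(1) y unfolding h unfolding e by simp
      moreover have "w = w'" using xy(1,2) eq e by (auto simp: doubleton_eq_iff)
      ultimately show "x = y" using eq e by simp
    qed
    show "?h ` ?T = through_groves i j u"
    proof (intro equalityI subsetI)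
      fix H assume "H \<in> ?h ` ?T"
      then obtain w e F where T: "(w, e, F) \<in> ?T" and H: "H = insert e F" by auto
      have "H - {e} = F" using ins[OF T] H by auto
      then show "H \<in> through_groves i j u"
        using T ins[OF T] H unfolding through_groves_def by auto
    next
      fix H assume "H \<in> through_groves i j u"
      then obtain e w where H: "H \<in> linked_groves n G i j" and e: "e \<in> H" "ends G e = {u, w}"
        and c: "(u, bdry G i) \<in> connected_by G (H - {e})" "(w, bdry G j) \<in> connected_by G (H - {e})"
        unfolding through_groves_def by blast
      have "e \<in> edges G" using H e by (auto simp: linked_groves_def)
      then have "(w, e, H - {e}) \<in> ?T"
        using remove_edge_rooted[OF H e ij(1,2) c] e c edge_ends_in_verts by auto
      moreover have "H = ?h (w, e, H - {e})" using e by auto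
      ultimately show "H \<in> ?h ` ?T" by (rule rev_image_eqI)
    qed
  qed
  then have "(\<Sum>H\<in>through_groves i j u. grove_weight G H) = (\<Sum>x\<in>?T. grove_weight G (?h x))"
    by (rule sum.reindex_bij_betw[symmetric])
  also have "\<dots> = (\<Sum>(w, e, F)\<in>?T. cond G e * grove_weight G F)"
  proof (rule sum.cong[OF refl])
    fix x assume "x \<in> ?T"
    moreover obtain w e F where x: "x = (w, e, F)" by (metis prod_cases3)
    ultimately have "e \<notin> F" "finite F" using ins[of w e F] finite_grove by auto
    then show "grove_weight G (?h x) = (case x of (w, e, F) \<Rightarrow> cond G e * grove_weight G F)"
      by (simp add: grove_weight_def x)
  qed
  also have "\<dots> = (\<Sum>w\<in>verts G. \<Sum>(e, F)\<in>?E w \<times> ?F w. cond G e * grove_weight G F)"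
    by (subst sum.Sigma[symmetric]) (use fin in auto)
  also have "\<dots> = (\<Sum>w\<in>verts G. \<Sum>e\<in>?E w. \<Sum>F\<in>?F w. cond G e * grove_weight G F)"
    by (simp add: sum.cartesian_product)
  finally show ?thesis by simp
qed

text \<open>Up to the total weight of all rooted groves, this is the potential with boundary value 1
  at \<open>j\<close> and 0 at the other boundary vertices; see \<open>root_potential_bdry\<close>
  and \<open>harmonic_root_potential\<close>.\<close>

definition root_potential :: "nat \<Rightarrow> 'v \<Rightarrow> real" where
  "root_potential j u =
     (\<Sum>F\<in>{F \<in> rooted_groves n G. (u, bdry G j) \<in> connected_by G F}. grove_weight G F)"

lemma root_potential_bdry:
  assumes "i < n" "j < n"
  shows "root_potential j (bdry G i) =
    (if i = j then \<Sum>F\<in>rooted_groves n G. grove_weight G F else 0)"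
proof -
  have "{F \<in> rooted_groves n G. (bdry G i, bdry G j) \<in> connected_by G F} =
    (if i = j then rooted_groves n G else {})"
    using assms by (auto simp: rooted_groves_iff)
  then show ?thesis by (simp add: root_potential_def)
qed

text \<open>Groves linking both \<open>u\<close> and \<open>w\<close> to \<open>j\<close> cancel. In
  those that remain exactly one of the two is linked to \<open>j\<close>, and the sum is sorted by
  the root \<open>i\<close> of the other one.\<close>

lemma root_potential_diff:
  assumes uw: "u \<in> verts G" "w \<in> verts G" and j: "j < n"
  defines "T \<equiv> \<lambda>i k. {F \<in> rooted_groves n G.
    (u, bdry G i) \<in> connected_by G F \<and> (w, bdry G k) \<in> connected_by G F}"
  shows "root_potential j w - root_potential j u =
    (\<Sum>i\<in>{..<n} - {j}. (\<Sum>F\<in>T i j. grove_weight G F) - (\<Sum>F\<in>T j i. grove_weight G F))"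
proof -
  let ?c = "\<lambda>v k F. (v, bdry G k) \<in> connected_by G F"
  let ?wt = "grove_weight G"
  have *: "(if ?c w j F then ?wt F else 0) - (if ?c u j F then ?wt F else 0) =
      (\<Sum>i\<in>{..<n} - {j}. (if ?c u i F \<and> ?c w j F then ?wt F else 0) -
         (if ?c u j F \<and> ?c w i F then ?wt F else 0))"
    if F: "F \<in> rooted_groves n G" for F
  proof -
    \<comment> \<open>The roots of \<open>u\<close> and \<open>w\<close> are \<open>a\<close> and
      \<open>b\<close>, so each of the two indicators is nonzero for at most one
      \<open>i\<close>.\<close>
    obtain a b where a: "a < n" "?c u a F" and b: "b < n" "?c w b F"
      using F uw by (meson rooted_groves_iff)
    have ca: "?c u k F \<longleftrightarrow> k = a" if "k < n" for k
      using rooted_grove_root_unique[OF F that a(1) _ a(2)] a(2) by blast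
    have cb: "?c w k F \<longleftrightarrow> k = b" if "k < n" for k
      using rooted_grove_root_unique[OF F that b(1) _ b(2)] b(2) by blast
    have "(\<Sum>i\<in>{..<n} - {j}. (if ?c u i F \<and> ?c w j F then ?wt F else 0) -
         (if ?c u j F \<and> ?c w i F then ?wt F else 0)) =
      (\<Sum>i\<in>{..<n} - {j}. (if i = a then if j = b then ?wt F else 0 else 0)) -
      (\<Sum>i\<in>{..<n} - {j}. (if i = b then if j = a then ?wt F else 0 else 0))"
      unfolding sum_subtractf[symmetric] by (rule sum.cong) (use ca cb j in auto)
    then show ?thesis using ca[OF j] cb[OF j] a(1) b(1) j by (auto simp: sum.delta)
  qed
  have "root_potential j w - root_potential j u = (\<Sum>F\<in>rooted_groves n G.
      (if ?c w j F then ?wt F else 0) - (if ?c u j F then ?wt F else 0))"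
    by (simp add: root_potential_def sum.inter_filter sum_subtractf)
  also have "\<dots> = (\<Sum>F\<in>rooted_groves n G. \<Sum>i\<in>{..<n} - {j}.
      (if ?c u i F \<and> ?c w j F then ?wt F else 0) - (if ?c u j F \<and> ?c w i F then ?wt F else 0))"
    by (rule sum.cong[OF refl *])
  also have "\<dots> = (\<Sum>i\<in>{..<n} - {j}. \<Sum>F\<in>rooted_groves n G.
      (if ?c u i F \<and> ?c w j F then ?wt F else 0) - (if ?c u j F \<and> ?c w i F then ?wt F else 0))"
    by (rule sum.swap)
  finally show ?thesis by (simp add: T_def sum.inter_filter sum_subtractf)
qed

text \<open>Weighting the potential differences by conductances adds an edge at \<open>u\<close> to
  each rooted grove. The two signs belong to the two directions in which the path between
  \<open>i\<close> and \<open>j\<close> can leave \<open>u\<close> along that edge.\<close>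

lemma inflow_root_potential:
  assumes u: "u \<in> verts G" and j: "j < n"
  shows "inflow G (root_potential j) u = (\<Sum>i\<in>{..<n} - {j}.
    (\<Sum>H\<in>through_groves i j u. grove_weight G H) - (\<Sum>H\<in>through_groves j i u. grove_weight G H))"
proof -
  let ?E = "\<lambda>w. {e \<in> edges G. ends G e = {u, w}}"
  let ?T = "\<lambda>w i k. {F \<in> rooted_groves n G.
    (u, bdry G i) \<in> connected_by G F \<and> (w, bdry G k) \<in> connected_by G F}"
  let ?wt = "grove_weight G"
  have "inflow G (root_potential j) u = (\<Sum>w\<in>verts G. \<Sum>e\<in>?E w. \<Sum>i\<in>{..<n} - {j}.
      (\<Sum>F\<in>?T w i j. cond G e * ?wt F) - (\<Sum>F\<in>?T w j i. cond G e * ?wt F))"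
    unfolding inflow_def
    by (intro sum.cong refl)
      (simp add: root_potential_diff[OF u _ j] sum_distrib_left right_diff_distrib)
  also have "\<dots> = (\<Sum>w\<in>verts G. \<Sum>i\<in>{..<n} - {j}. \<Sum>e\<in>?E w.
      (\<Sum>F\<in>?T w i j. cond G e * ?wt F) - (\<Sum>F\<in>?T w j i. cond G e * ?wt F))"
    by (intro sum.cong refl sum.swap)
  also have "\<dots> = (\<Sum>i\<in>{..<n} - {j}. \<Sum>w\<in>verts G. \<Sum>e\<in>?E w.
      (\<Sum>F\<in>?T w i j. cond G e * ?wt F) - (\<Sum>F\<in>?T w j i. cond G e * ?wt F))"
    by (rule sum.swap)
  also have "\<dots> = (\<Sum>i\<in>{..<n} - {j}.
    (\<Sum>H\<in>through_groves i j u. ?wt H) - (\<Sum>H\<in>through_groves j i u. ?wt H))"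
    by (rule sum.cong[OF refl])
      (use j in \<open>simp add: sum_subtractf through_groves_sum[symmetric]\<close>)
  finally show ?thesis .
qed

text \<open>A path from \<open>i\<close> to \<open>j\<close> through \<open>u\<close>, with
  \<open>u\<close> different from its starting point, also has an edge \<open>f\<close> at
  \<open>u\<close> on the side of \<open>i\<close>; deleting \<open>f\<close> leaves
  \<open>u\<close> linked to \<open>j\<close>. At interior vertices both inclusions hold, so the
  inflow cancels.\<close>

lemma through_groves_commute:
  assumes ij: "i < n" "j < n" "i \<noteq> j" and u: "u \<noteq> bdry G i"
  shows "through_groves i j u \<subseteq> through_groves j i u"
proof
  fix H assume "H \<in> through_groves i j u"
  then obtain e w where H: "H \<in> linked_groves n G i j" and e: "e \<in> H" "ends G e = {u, w}"
    and c: "(u, bdry G i) \<in> connected_by G (H - {e})" "(w, bdry G j) \<in> connected_by G (H - {e})"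
    unfolding through_groves_def by blast
  have cH: "(a, b) \<in> connected_by G H" if "(a, b) \<in> connected_by G (H - {e})" for a b
    using that by (rule connected_by_mono) auto
  obtain f w' where f: "f \<in> H" "ends G f = {u, w'}" "(w', bdry G i) \<in> connected_by G (H - {f})"
    using first_edge_exists[OF cH[OF c(1)] u] by blast
  have "(u, w) \<notin> connected_by G (H - {e})" using H e by (auto simp: linked_groves_def forest_def)
  moreover have br: "(u, w') \<notin> connected_by G (H - {f})"
    using H f by (auto simp: linked_groves_def forest_def)
  ultimately have "(u, bdry G i) \<notin> connected_by G (H - {f})"
    using f(3) connected_by_sym connected_by_trans by metis
  moreover have "(u, bdry G j) \<in> connected_by G (insert f (H - {f}))"
  proof -
    have "insert f (H - {f}) = H" using f by auto
    then show ?thesis using connected_by_edge[OF e] cH[OF c(2)] connected_by_trans by metis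
  qed
  \<comment> \<open>If \<open>w'\<close> still reached \<open>j\<close>, then \<open>f\<close> would
    be the first edge from \<open>u\<close> towards \<open>j\<close>, hence equal to
    \<open>e\<close>. Both ends of \<open>f\<close> would then reach \<open>i\<close> without it, so
    \<open>f\<close> would not be a bridge.\<close>
  moreover have "(w', bdry G j) \<notin> connected_by G (H - {f})"
  proof
    assume w'j: "(w', bdry G j) \<in> connected_by G (H - {f})"
    have "forest G H" using H by (simp add: linked_groves_def)
    then have "e = f" using first_edge_unique e c(2) f w'j by metis
    moreover from this have "w = w'" using e f by (auto simp: doubleton_eq_iff)
    ultimately show False
      using c(1) f(3) br connected_by_sym connected_by_trans by metis
  qed
  ultimately have "(u, bdry G j) \<in> connected_by G (H - {f})"
    unfolding connected_by_insert[OF f(2)] by blast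
  then show "H \<in> through_groves j i u"
    using H f unfolding through_groves_def linked_groves_commute[of n G i j] by blast
qed

lemma harmonic_root_potential:
  assumes j: "j < n"
  shows "harmonic_inside n G (root_potential j)"
  unfolding harmonic_inside_def
proof
  fix u assume u: "u \<in> verts G - bdry G ` {..<n}"
  have "through_groves i j u = through_groves j i u" if "i \<in> {..<n} - {j}" for i
    using through_groves_commute[of i j u] through_groves_commute[of j i u] that j u by blast
  then show "inflow G (root_potential j) u = 0"
    using u by (simp add: inflow_root_potential[OF _ j])
qed

text \<open>Deleting the edge leaves a rooted grove that links the boundary vertices
  \<open>k\<close> and \<open>i\<close>, which forces \<open>k = i\<close>. At \<open>i\<close>
  itself the first edge towards \<open>j\<close> always qualifies.\<close>

lemma through_groves_bdry:
  assumes ij: "i < n" "j < n" "i \<noteq> j" and k: "k < n"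
  shows "through_groves i j (bdry G k) = (if k = i then linked_groves n G i j else {})"
proof -
  have "k = i" if through: "H \<in> through_groves i j (bdry G k)" for H
  proof -
    obtain e w where H: "H \<in> linked_groves n G i j" and e: "e \<in> H" "ends G e = {bdry G k, w}"
      and c: "(bdry G k, bdry G i) \<in> connected_by G (H - {e})"
        "(w, bdry G j) \<in> connected_by G (H - {e})"
      using through unfolding through_groves_def by blast
    show ?thesis
      using remove_edge_rooted[OF H e ij(1,2) c] c(1) k ij by (simp add: rooted_groves_iff)
  qed
  moreover have "H \<in> through_groves i j (bdry G i)" if H: "H \<in> linked_groves n G i j" for H
  proof -
    have "(bdry G i, bdry G j) \<in> connected_by G H"
      using H ij by (auto simp: linked_groves_def)
    moreover have "bdry G i \<noteq> bdry G j"
      using net ij by (auto simp: electrical_network_def inj_on_def)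
    ultimately obtain e w where "e \<in> H" "ends G e = {bdry G i, w}"
      "(w, bdry G j) \<in> connected_by G (H - {e})"
      using first_edge_exists by metis
    then show ?thesis using H unfolding through_groves_def by auto
  qed
  ultimately show ?thesis by (auto simp: through_groves_def)
qed

lemma inflow_root_potential_bdry:
  assumes ij: "i < n" "j < n" "i \<noteq> j"
  shows "inflow G (root_potential j) (bdry G i) = (\<Sum>H\<in>linked_groves n G i j. grove_weight G H)"
proof -
  have "inflow G (root_potential j) (bdry G i) =
      (\<Sum>k\<in>{..<n} - {j}. if k = i then \<Sum>H\<in>linked_groves n G i j. grove_weight G H else 0)"
    unfolding inflow_root_potential[OF bdry_in_verts[OF ij(1)] ij(2)]
    using ij by (intro sum.cong) (auto simp: through_groves_bdry)
  then show ?thesis using ij by simp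
qed

text \<open>The boundary values of \<open>root_potential j\<close> are a multiple of a unit vector,
  so \<open>L\<close> applied to them returns a multiple of column \<open>j\<close>; the inflow at
  \<open>i\<close> is the weight of the groves linking \<open>i\<close> and
  \<open>j\<close>.\<close>

lemma response_matrix_entry:
  assumes L: "is_response_matrix n G L" and ij: "i < n" "j < n" "i \<noteq> j"
  shows "L $$ (i, j) * grove_measurement n G (pair_partition n 0 0) =
    grove_measurement n G (pair_partition n i j)"
proof -
  let ?Z = "\<Sum>F\<in>rooted_groves n G. grove_weight G F"
  have Lc: "L \<in> carrier_mat n n" using L by (simp add: is_response_matrix_def)
  have v: "Matrix.vec n (\<lambda>i. root_potential j (bdry G i)) = ?Z \<cdot>\<^sub>v unit_vec n j"
    using ij by (intro eq_vecI) (auto simp: root_potential_bdry)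
  have "L *\<^sub>v (?Z \<cdot>\<^sub>v unit_vec n j) =
    Matrix.vec n (\<lambda>i. inflow G (root_potential j) (bdry G i))"
    using L harmonic_root_potential[OF ij(2)] unfolding v[symmetric] is_response_matrix_def by blast
  then have "vec_index (L *\<^sub>v (?Z \<cdot>\<^sub>v unit_vec n j)) i =
    (\<Sum>H\<in>linked_groves n G i j. grove_weight G H)"
    using ij by (simp add: inflow_root_potential_bdry)
  moreover have "vec_index (L *\<^sub>v (?Z \<cdot>\<^sub>v unit_vec n j)) i = ?Z * L $$ (i, j)"
    using Lc ij by (simp add: scalar_prod_right_unit)
  ultimately show ?thesis by (simp add: grove_measurement_pair mult.commute)
qed

text \<open>Constant voltages produce no current.\<close>

lemma response_matrix_row_sum:
  assumes L: "is_response_matrix n G L" and i: "i < n"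
  shows "(\<Sum>j<n. L $$ (i, j)) = 0"
proof -
  have Lc: "L \<in> carrier_mat n n" using L by (simp add: is_response_matrix_def)
  have "harmonic_inside n G (\<lambda>_. 1)" by (simp add: harmonic_inside_def inflow_def)
  then have "L *\<^sub>v Matrix.vec n (\<lambda>_. 1) = Matrix.vec n (\<lambda>i. inflow G (\<lambda>_. 1) (bdry G i))"
    using L unfolding is_response_matrix_def by blast
  then have "vec_index (L *\<^sub>v Matrix.vec n (\<lambda>_. 1)) i = 0"
    using i by (simp add: inflow_def)
  then show ?thesis
    using Lc i by (simp add: scalar_prod_def atLeast0LessThan)
qed

text \<open>The pair of linked boundary vertices is unordered, so both entries have the same product
  with the rooted measurement, which can be cancelled.\<close>

lemma response_matrix_symmetric:
  assumes L: "is_response_matrix n G L" and Z: "grove_measurement n G (pair_partition n 0 0) \<noteq> 0"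
    and ij: "i < n" "j < n"
  shows "L $$ (i, j) = L $$ (j, i)"
proof (cases "i = j")
  case False
  have "pair_partition n i j = pair_partition n j i"
    by (simp add: pair_partition_def insert_commute)
  then show ?thesis
    using response_matrix_entry[OF L ij False] response_matrix_entry[OF L ij(2,1)] False Z
    by (metis mult_cancel_right)
qed simp

lemma rooted_measurement_pos:
  assumes "grove n G F"
  shows "grove_measurement n G (pair_partition n 0 0) > 0"
proof -
  define P where "P F \<longleftrightarrow> F \<subseteq> edges G \<and> forest G F \<and>
    (\<forall>v\<in>verts G. \<exists>k<n. (v, bdry G k) \<in> connected_by G F)" for F
  have fin: "finite F" if "P F" for F
    using that net by (auto simp: P_def electrical_network_def intro: finite_subset)
  have "P F" using assms by (simp add: P_def grove_def forest_iff_no_cycle)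
  \<comment> \<open>If two boundary vertices were linked in a smallest such \<open>H\<close>, the
    first edge of the path between them could be dropped; hence \<open>H\<close> is rooted.\<close>
  then obtain H where H: "P H" and min: "\<And>K. P K \<Longrightarrow> card H \<le> card K"
    by (metis ex_has_least_nat)
  have "k = l" if kl: "k < n" "l < n" and c: "(bdry G k, bdry G l) \<in> connected_by G H" for k l
  proof (rule ccontr)
    assume "k \<noteq> l"
    then have "bdry G k \<noteq> bdry G l" using net kl by (auto simp: electrical_network_def inj_on_def)
    then obtain e w where e: "e \<in> H" "ends G e = {bdry G k, w}"
      "(w, bdry G l) \<in> connected_by G (H - {e})"
      using first_edge_exists[OF c] by metis
    have "\<exists>m<n. (v, bdry G m) \<in> connected_by G (H - {e})" if v: "v \<in> verts G" for v
    proof -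
      have "insert e (H - {e}) = H" using e by auto
      then obtain m where "m < n" "(v, bdry G m) \<in> connected_by G (insert e (H - {e}))"
        using H v by (auto simp: P_def)
      then show ?thesis
        using e(3) kl connected_by_trans unfolding connected_by_insert[OF e(2)] by metis
    qed
    then have "P (H - {e})" using H forest_subset[of G H "H - {e}"] by (auto simp: P_def)
    from min[OF this] show False using card_Diff1_less[OF fin[OF H] e(1)] by simp
  qed
  then have ne: "H \<in> rooted_groves n G" using H by (auto simp: P_def rooted_groves_iff)
  have "grove_weight G F > 0" if "F \<in> rooted_groves n G" for F
    using net that unfolding grove_weight_def electrical_network_def rooted_groves_iff
    by (intro prod_pos) blast
  then show ?thesis
    unfolding grove_measurement_pair using ne by (intro sum_pos) auto
qed

end

section \<open>Partitions with a single pair\<close>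

lemma pair_partition_eq:
  assumes "i < n" "j < n"
  shows "pair_partition n i j = insert {i, j} ((\<lambda>k. {k}) ` ({..<n} - {i, j}))"
proof -
  let ?R = "{(k, l). k < n \<and> l < n \<and> (k = l \<or> {k, l} = {i, j})}"
  have "?R `` {k} = (if k \<in> {i, j} then {i, j} else {k})" if "k < n" for k
    using assms that by (auto simp: doubleton_eq_iff)
  then have "pair_partition n i j = (\<lambda>k. if k \<in> {i, j} then {i, j} else {k}) ` {..<n}"
    unfolding pair_partition_def quotient_def by auto
  then show ?thesis using assms by auto
qed

lemma pair_partition_commute: "pair_partition n i j = pair_partition n j i"
  by (simp add: pair_partition_def insert_commute)

lemma nc_partition_pair:
  assumes "i < n" "j < n"
  shows "nc_partition n (pair_partition n i j)"
proof -
  have "partition_on {..<n} (pair_partition n i j)"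
    unfolding pair_partition_def using equiv_pair by (rule partition_on_quotient)
  moreover have "noncrossing (pair_partition n i j)"
    unfolding noncrossing_def pair_partition_eq[OF assms] by auto
  ultimately show ?thesis by (simp add: nc_partition_def)
qed

text \<open>With zero-based labels, the tilde label \<open>x\<close> lies between \<open>i\<close>
  and \<open>j\<close> exactly when \<open>i \<le> x\<close> and \<open>x < j\<close>, so the chord
  from \<open>i\<close> to \<open>j\<close> separates the tilde labels into these two sets. For
  \<open>i = j\<close> the first set is empty and is discarded.\<close>

lemma kreweras_pair:
  assumes ij: "i \<le> j" "j < n"
  shows "kreweras n (pair_partition n i j) = {{i..<j}, {..<n} - {i..<j}} - {{}}"
proof -
  define \<sigma> where "\<sigma> = pair_partition n i j"
  define \<tau>\<^sub>0 where "\<tau>\<^sub>0 = {{i..<j}, {..<n} - {i..<j}} - {{}}"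
  have i: "i < n" using ij by simp
  have \<sigma>: "\<sigma> = insert {i, j} ((\<lambda>k. {k}) ` ({..<n} - {i, j}))"
    unfolding \<sigma>_def by (rule pair_partition_eq[OF i ij(2)])
  \<comment> \<open>Since \<open>noncrossing\<close> speaks of distinct blocks only, blocks of the
    two kinds have to be told apart; parity does this.\<close>
  have parity: "pos ` S \<noteq> tpos ` T" if ne: "S \<noteq> {}" for S T
  proof
    assume eq: "pos ` S = tpos ` T"
    obtain x where "x \<in> S" using ne by blast
    then obtain y where "pos x = tpos y" using eq by blast
    then show False unfolding pos_def tpos_def by presburger
  qed
  have \<tau>_part: "partition_on {..<n} \<tau>\<^sub>0"
    using ij by (intro partition_onI) (auto simp: disjnt_def \<tau>\<^sub>0_def)
  have \<tau>_nc: "noncrossing \<tau>\<^sub>0"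
    unfolding noncrossing_def
  proof (intro ballI impI notI, elim exE conjE)
    fix A B a b c d
    assume "A \<in> \<tau>\<^sub>0" "B \<in> \<tau>\<^sub>0" "A \<noteq> B"
    then consider "A = {i..<j}" "B = {..<n} - {i..<j}" | "A = {..<n} - {i..<j}" "B = {i..<j}"
      unfolding \<tau>\<^sub>0_def by blast
    moreover assume "a < b" "b < c" "c < d" "a \<in> A" "c \<in> A" "b \<in> B" "d \<in> B"
    ultimately show False by cases auto
  qed
  have inside: "i \<le> y \<and> y < j" if "T \<in> \<tau>\<^sub>0" "x \<in> T" "y \<in> T" "i \<le> x" "x < j" for T x y
    using that by (auto simp: \<tau>\<^sub>0_def)
  have joint: "noncrossing (joint_partition \<sigma> \<tau>\<^sub>0)"
    unfolding noncrossing_def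
  proof (intro ballI impI notI, elim exE conjE)
    fix A B a b c d
    assume AB: "A \<in> joint_partition \<sigma> \<tau>\<^sub>0" "B \<in> joint_partition \<sigma> \<tau>\<^sub>0" "A \<noteq> B"
      and l: "a < b" "b < c" "c < d" and m: "a \<in> A" "c \<in> A" "b \<in> B" "d \<in> B"
    have pair: "a' = i \<and> c' = j" if "S \<in> \<sigma>" "a' \<in> S" "c' \<in> S" "a' < c'" for S a' c'
      using that ij unfolding \<sigma> by auto
    consider S T where "S \<in> \<sigma>" "T \<in> \<sigma>" "A = pos ` S" "B = pos ` T"
      | S T where "S \<in> \<sigma>" "T \<in> \<tau>\<^sub>0" "A = pos ` S" "B = tpos ` T"
      | S T where "S \<in> \<tau>\<^sub>0" "T \<in> \<sigma>" "A = tpos ` S" "B = pos ` T"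
      | S T where "S \<in> \<tau>\<^sub>0" "T \<in> \<tau>\<^sub>0" "A = tpos ` S" "B = tpos ` T"
      using AB(1,2) unfolding joint_partition_def by blast
    then show False
    proof cases
      case 1
      then obtain a' b' c' d' where "a = pos a'" "b = pos b'" "c = pos c'" "d = pos d'"
        "a' \<in> S" "c' \<in> S" "b' \<in> T" "d' \<in> T" using m by blast
      then show False using 1(1,2) l pair[of S a' c'] pair[of T b' d'] by (auto simp: pos_def)
    next
      case 2
      then obtain a' b' c' d' where "a = pos a'" "b = tpos b'" "c = pos c'" "d = tpos d'"
        "a' \<in> S" "c' \<in> S" "b' \<in> T" "d' \<in> T" using m by blast
      then show False using 2(1,2) l pair[of S a' c'] inside[of T b' d'] by (auto simp: pos_def tpos_def)
    next
      case 3
      then obtain a' b' c' d' where "a = tpos a'" "b = pos b'" "c = tpos c'" "d = pos d'"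
        "a' \<in> S" "c' \<in> S" "b' \<in> T" "d' \<in> T" using m by blast
      then show False using 3(1,2) l pair[of T b' d'] inside[of S c' a'] by (auto simp: pos_def tpos_def)
    next
      case 4
      then obtain a' b' c' d' where "a = tpos a'" "b = tpos b'" "c = tpos c'" "d = tpos d'"
        "a' \<in> S" "c' \<in> S" "b' \<in> T" "d' \<in> T" using m by blast
      moreover from this have "a' < b'" "b' < c'" "c' < d'" using l by (auto simp: tpos_def)
      moreover have "S \<noteq> T" using 4 AB by blast
      ultimately show False
        using \<tau>_nc 4(1,2) unfolding noncrossing_def by metis
    qed
  qed
  have coarsest: "refines {..<n} \<tau>' \<tau>\<^sub>0"
    if \<tau>': "nc_partition n \<tau>'" and nc: "noncrossing (joint_partition \<sigma> \<tau>')" for \<tau>'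
  proof -
    have part: "partition_on {..<n} \<tau>'" using \<tau>' by (simp add: nc_partition_def)
    \<comment> \<open>A block contained in neither side has a label \<open>x\<close> under the chord
      and a label \<open>y\<close> outside it, so it crosses the block
      \<open>{i, j}\<close>.\<close>
    have "\<exists>C\<in>\<tau>\<^sub>0. B \<subseteq> C" if B: "B \<in> \<tau>'" for B
    proof (rule ccontr)
      assume no: "\<not> (\<exists>C\<in>\<tau>\<^sub>0. B \<subseteq> C)"
      have Bn: "B \<subseteq> {..<n}" "B \<noteq> {}" using part B by (auto simp: partition_on_def)
      have "j \<in> {..<n} - {i..<j}" using ij by simp
      then have "{..<n} - {i..<j} \<in> \<tau>\<^sub>0" unfolding \<tau>\<^sub>0_def by blast
      then have "\<not> B \<subseteq> {..<n} - {i..<j}" using no by blast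
      then obtain x where "x \<in> B" "x \<in> {i..<j}" using Bn(1) by blast
      then have x: "x \<in> B" "i \<le> x" "x < j" by simp_all
      have "{i..<j} \<in> \<tau>\<^sub>0" using x by (auto simp: \<tau>\<^sub>0_def)
      then have "\<not> B \<subseteq> {i..<j}" using no by blast
      then obtain y where "y \<in> B" "y \<notin> {i..<j}" by blast
      then have y: "y \<in> B" "y < i \<or> j \<le> y" by auto
      have P: "pos ` {i, j} \<in> joint_partition \<sigma> \<tau>'" "tpos ` B \<in> joint_partition \<sigma> \<tau>'"
        using B unfolding joint_partition_def \<sigma> by auto
      have neq: "pos ` {i, j} \<noteq> tpos ` B" by (rule parity) simp
      have mem: "pos i \<in> pos ` {i, j}" "pos j \<in> pos ` {i, j}" "tpos x \<in> tpos ` B" "tpos y \<in> tpos ` B"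
        using x y by auto
      from y(2) show False
      proof
        assume "y < i"
        then have "tpos y < pos i" "pos i < tpos x" "tpos x < pos j"
          using x by (auto simp: pos_def tpos_def)
        then show False using nc P neq mem unfolding noncrossing_def by metis
      next
        assume "j \<le> y"
        then have "pos i < tpos x" "tpos x < pos j" "pos j < tpos y"
          using x by (auto simp: pos_def tpos_def)
        then show False using nc P neq mem unfolding noncrossing_def by metis
      qed
    qed
    then show ?thesis using part \<tau>_part by (simp add: refines_def)
  qed
  show ?thesis
    unfolding kreweras_def \<sigma>_def[symmetric] \<tau>\<^sub>0_def[symmetric]
  proof (rule the_equality)
    show "nc_partition n \<tau>\<^sub>0 \<and> noncrossing (joint_partition \<sigma> \<tau>\<^sub>0) \<and>
      (\<forall>\<tau>'. nc_partition n \<tau>' \<and> noncrossing (joint_partition \<sigma> \<tau>') \<longrightarrow> refines {..<n} \<tau>' \<tau>\<^sub>0)"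
      using \<tau>_part \<tau>_nc joint coarsest by (simp add: nc_partition_def)
    then show "\<tau> = \<tau>\<^sub>0" if "nc_partition n \<tau> \<and> noncrossing (joint_partition \<sigma> \<tau>) \<and>
      (\<forall>\<tau>'. nc_partition n \<tau>' \<and> noncrossing (joint_partition \<sigma> \<tau>') \<longrightarrow> refines {..<n} \<tau>' \<tau>)" for \<tau>
      using that by (metis refines_asym)
  qed
qed

section \<open>The Plucker coordinates of the grove vector that determine the rows\<close>

lemma finite_nc_partitions: "finite {\<sigma>. nc_partition n \<sigma>}"
  by (rule finite_subset[of _ "Pow (Pow {..<n})"]) (auto simp: nc_partition_def partition_on_def)

text \<open>The full set meets a block once only if the block is a singleton. The Kreweras
  complement of the singletons is one block, which any \<open>k\<close> meets once, so the value
  does not depend on \<open>k\<close>.\<close>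

lemma f_vec_full:
  assumes k: "k < n" and \<sigma>: "nc_partition n \<sigma>"
  shows "f_vec n \<sigma> {..<n} {k} = (if \<sigma> = pair_partition n 0 0 then 1 else 0)"
proof -
  have n: "0 < n" using k by simp
  have part: "partition_on {..<n} \<sigma>" using \<sigma> by (simp add: nc_partition_def)
  have p: "pair_partition n 0 0 = (\<lambda>k. {k}) ` {..<n}"
    using n by (auto simp: pair_partition_eq)
  have "kreweras n (pair_partition n 0 0) = {{..<n}}"
    using kreweras_pair[of 0 0 n] n by auto
  then have "concordant {..<n} {k} (pair_partition n 0 0) (kreweras n (pair_partition n 0 0))"
    using k by (auto simp: concordant_def p)
  moreover have "\<sigma> = pair_partition n 0 0" if c: "\<forall>B\<in>\<sigma>. card ({..<n} \<inter> B) = 1"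
  proof -
    have U: "\<Union>\<sigma> = {..<n}" using part by (simp add: partition_on_def)
    have single: "\<exists>m. B = {m}" if "B \<in> \<sigma>" for B
    proof -
      have "{..<n} \<inter> B = B" using U that by blast
      then show ?thesis using c that by (metis card_1_singletonE)
    qed
    show ?thesis unfolding p
    proof (intro equalityI subsetI)
      fix B assume B: "B \<in> \<sigma>"
      with single obtain m where "B = {m}" by blast
      then show "B \<in> (\<lambda>k. {k}) ` {..<n}" using B U by blast
    next
      fix B assume "B \<in> (\<lambda>k. {k}) ` {..<n}"
      then obtain m where m: "B = {m}" "m < n" by blast
      then obtain C where "C \<in> \<sigma>" "m \<in> C" using U by blast
      then show "B \<in> \<sigma>" using single m by blast
    qed
  qed
  ultimately show ?thesis
    unfolding f_vec_def by (metis concordant_def)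
qed

lemma grove_vector_full:
  assumes k: "k < n"
  shows "grove_vector n G {..<n} {k} = grove_measurement n G (pair_partition n 0 0)"
proof -
  have "grove_vector n G {..<n} {k} = (\<Sum>\<sigma>\<in>{\<sigma>. nc_partition n \<sigma>}.
      if \<sigma> = pair_partition n 0 0 then grove_measurement n G \<sigma> else 0)"
    unfolding grove_vector_def by (rule sum.cong) (use k in \<open>auto simp: f_vec_full\<close>)
  then show ?thesis
    using k nc_partition_pair[of 0 n 0] by (simp add: finite_nc_partitions)
qed

text \<open>The index set without \<open>i\<close> meets the pair in \<open>j\<close> alone. What
  remains is the condition that the chord from \<open>i\<close> to \<open>j\<close> separates the
  tilde labels \<open>k\<close> and \<open>l\<close>.\<close>

lemma f_vec_omit_pair:
  assumes ij: "i < n" "j < n" "i \<noteq> j" and kl: "k < n" "l < n" "k \<noteq> l"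
  shows "f_vec n (pair_partition n i j) ({..<n} - {i}) {k, l} =
    (if (k \<in> {min i j..<max i j}) \<noteq> (l \<in> {min i j..<max i j}) then 1 else 0)"
proof -
  let ?T = "{min i j..<max i j}"
  have "pair_partition n i j = pair_partition n (min i j) (max i j)"
    by (cases "i \<le> j") (auto simp: pair_partition_commute min_def max_def)
  then have "kreweras n (pair_partition n i j) = {?T, {..<n} - ?T} - {{}}"
    using kreweras_pair[of "min i j" "max i j" n] ij by simp
  moreover have "?T \<noteq> {}" using ij by auto
  moreover have "max i j \<in> {..<n} - ?T" using ij by auto
  then have "{..<n} - ?T \<noteq> {}" by blast
  ultimately have kr: "kreweras n (pair_partition n i j) = {?T, {..<n} - ?T}" by blast
  have I: "card (({..<n} - {i}) \<inter> B) = 1" if "B \<in> pair_partition n i j" for B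
  proof -
    have "({..<n} - {i}) \<inter> {i, j} = {j}" using ij by auto
    moreover have "({..<n} - {i}) \<inter> {m} = {m}" if "m \<in> {..<n} - {i, j}" for m using that by auto
    moreover have "B = {i, j} \<or> (\<exists>m\<in>{..<n} - {i, j}. B = {m})"
      using that unfolding pair_partition_eq[OF ij(1,2)] by blast
    ultimately show ?thesis by (metis is_singletonI is_singleton_altdef)
  qed
  have J: "card ({k, l} \<inter> A) = (if k \<in> A then if l \<in> A then 2 else 1 else if l \<in> A then 1 else 0)" for A
    using kl(3) by (cases "k \<in> A"; cases "l \<in> A") simp_all
  have "concordant ({..<n} - {i}) {k, l} (pair_partition n i j) {?T, {..<n} - ?T} \<longleftrightarrow>
    card ({k, l} \<inter> ?T) = 1 \<and> card ({k, l} \<inter> ({..<n} - ?T)) = 1"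
    unfolding concordant_def using I by blast
  also have "\<dots> \<longleftrightarrow> (k \<in> ?T) \<noteq> (l \<in> ?T)"
    unfolding J using kl by simp
  finally show ?thesis unfolding f_vec_def kr by simp
qed

text \<open>The block of \<open>i\<close> has exactly one further element \<open>j\<close>; every
  other block avoids \<open>i\<close> and is therefore a singleton.\<close>

lemma concordant_omit:
  assumes i: "i < n" and part: "partition_on {..<n} \<sigma>"
    and c: "\<forall>B\<in>\<sigma>. card (({..<n} - {i}) \<inter> B) = 1"
  shows "\<exists>j\<in>{..<n} - {i}. \<sigma> = pair_partition n i j"
proof -
  obtain B where B: "B \<in> \<sigma>" "i \<in> B" using part i by (auto simp: partition_on_def)
  have sub: "C \<subseteq> {..<n}" if "C \<in> \<sigma>" for C using part that by (auto simp: partition_on_def)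
  obtain j where j: "({..<n} - {i}) \<inter> B = {j}" using c B(1) by (metis card_1_singletonE)
  then have jn: "j \<in> {..<n} - {i}" by auto
  have Bij: "B = {i, j}" using j B(2) sub[OF B(1)] by auto
  have single: "\<exists>m\<in>{..<n} - {i, j}. C = {m}" if C: "C \<in> \<sigma>" "C \<noteq> B" for C
  proof -
    have dis: "C \<inter> B = {}" using partition_onD2[OF part] C B(1) by (auto simp: disjoint_def)
    then have "({..<n} - {i}) \<inter> C = C" using sub[OF C(1)] B(2) by auto
    then obtain m where "C = {m}" using c C(1) by (metis card_1_singletonE)
    then show ?thesis using dis sub[OF C(1)] Bij by auto
  qed
  have "\<sigma> = insert {i, j} ((\<lambda>k. {k}) ` ({..<n} - {i, j}))"
  proof (intro equalityI subsetI)
    fix C assume "C \<in> insert {i, j} ((\<lambda>k. {k}) ` ({..<n} - {i, j}))"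
    then consider "C = {i, j}" | m where "m \<in> {..<n} - {i, j}" "C = {m}" by blast
    then show "C \<in> \<sigma>"
    proof cases
      case 2
      then obtain D where D: "D \<in> \<sigma>" "m \<in> D" using part by (auto simp: partition_on_def)
      then have "D \<noteq> B" using Bij 2 by auto
      then show ?thesis using single[OF D(1)] D 2 by auto
    qed (use B Bij in simp)
  qed (use single Bij in auto)
  then have "\<sigma> = pair_partition n i j" using i jn by (simp add: pair_partition_eq)
  then show ?thesis using jn by blast
qed

text \<open>Only partitions whose single pair contains \<open>i\<close> contribute, and they are
  parametrized injectively by the partner \<open>j\<close>.\<close>

lemma grove_vector_omit:
  assumes i: "i < n" and kl: "k < n" "l < n" "k \<noteq> l"
  shows "grove_vector n G ({..<n} - {i}) {k, l} = (\<Sum>j\<in>{..<n} - {i}.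
    if (k \<in> {min i j..<max i j}) \<noteq> (l \<in> {min i j..<max i j})
    then grove_measurement n G (pair_partition n i j) else 0)"
proof -
  let ?J = "{..<n} - {i}"
  have inj: "inj_on (pair_partition n i) ?J"
  proof (rule inj_onI)
    fix j j' assume j: "j \<in> ?J" "j' \<in> ?J" and eq: "pair_partition n i j = pair_partition n i j'"
    have "{i, j} \<in> pair_partition n i j'" using i j eq[symmetric] by (simp add: pair_partition_eq)
    then show "j = j'" using i j by (auto simp: pair_partition_eq doubleton_eq_iff)
  qed
  have "grove_vector n G ?J {k, l} =
    (\<Sum>\<sigma>\<in>pair_partition n i ` ?J. grove_measurement n G \<sigma> * f_vec n \<sigma> ?J {k, l})"
    unfolding grove_vector_def
  proof (rule sum.mono_neutral_right[OF finite_nc_partitions])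
    show "pair_partition n i ` ?J \<subseteq> {\<sigma>. nc_partition n \<sigma>}" using i nc_partition_pair by auto
    show "\<forall>\<sigma>\<in>{\<sigma>. nc_partition n \<sigma>} - pair_partition n i ` ?J.
      grove_measurement n G \<sigma> * f_vec n \<sigma> ?J {k, l} = 0"
      using concordant_omit[OF i] by (fastforce simp: f_vec_def concordant_def nc_partition_def)
  qed
  also have "\<dots> = (\<Sum>j\<in>?J. grove_measurement n G (pair_partition n i j) *
      f_vec n (pair_partition n i j) ?J {k, l})"
    by (simp add: sum.reindex[OF inj])
  also have "\<dots> = (\<Sum>j\<in>?J. if (k \<in> {min i j..<max i j}) \<noteq> (l \<in> {min i j..<max i j})
    then grove_measurement n G (pair_partition n i j) else 0)"
  proof (rule sum.cong[OF refl])
    fix j assume "j \<in> ?J"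
    then have j: "j < n" "i \<noteq> j" by auto
    have "x * (if b then 1 else 0) = (if b then x else 0)" for x :: real and b by simp
    then show "grove_measurement n G (pair_partition n i j) * f_vec n (pair_partition n i j) ?J {k, l} =
      (if (k \<in> {min i j..<max i j}) \<noteq> (l \<in> {min i j..<max i j})
       then grove_measurement n G (pair_partition n i j) else 0)"
      unfolding f_vec_omit_pair[OF i j kl] .
  qed
  finally show ?thesis .
qed

section \<open>Row spaces and maximal minors\<close>

text \<open>As \<open>pick\<close> lists a set in increasing order, \<open>c\<close> takes the
  position given by the number of smaller elements, and \<open>insert_index\<close> moves the later
  elements up by one.\<close>

lemma pick_insert:
  assumes T: "finite T" and c: "c \<notin> T"
  shows "pick (insert c T) (card {t \<in> T. t < c}) = c"
    "j < card T \<Longrightarrow> pick (insert c T) (insert_index (card {t \<in> T. t < c}) j) = pick T j"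
proof -
  have "{a \<in> insert c T. a < c} = {t \<in> T. t < c}" by auto
  then show "pick (insert c T) (card {t \<in> T. t < c}) = c"
    using pick_card_in_set[of c "insert c T"] by simp
next
  assume j: "j < card T"
  define t where "t = pick T j"
  have t: "t \<in> T" "card {a \<in> T. a < t} = j"
    using pick_in_set_le[OF j] card_pick_le[OF j] by (simp_all add: t_def)
  have "card {a \<in> insert c T. a < t} = insert_index (card {t \<in> T. t < c}) j"
  proof (cases "c < t")
    case True
    have "card {a \<in> T. a < c} \<le> j"
      unfolding t(2)[symmetric] using True T by (intro card_mono) auto
    moreover have "{a \<in> insert c T. a < t} = insert c {a \<in> T. a < t}" using True by auto
    ultimately show ?thesis using T c t(2) by (simp add: insert_index_def)
  next
    case False
    then have tc: "t < c" using t(1) c by (cases "t = c") auto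
    have "card (insert t {a \<in> T. a < t}) \<le> card {a \<in> T. a < c}"
      using tc t(1) T by (intro card_mono) auto
    moreover have "{a \<in> insert c T. a < t} = {a \<in> T. a < t}" using False by auto
    ultimately show ?thesis using T t(2) by (simp add: insert_index_def)
  qed
  then show "pick (insert c T) (insert_index (card {t \<in> T. t < c}) j) = pick T j"
    using pick_card_in_set[of t "insert c T"] t(1) by (simp add: t_def)
qed

text \<open>The cofactor in row \<open>r\<close> of a column placed in front of the columns
  \<open>T\<close>. The sign for any other place is supplied in
  \<open>minor_cofactor_expansion\<close>.\<close>

definition minor_cofactor :: "nat \<Rightarrow> 'a :: field mat \<Rightarrow> nat set \<Rightarrow> nat \<Rightarrow> 'a" where
  "minor_cofactor k B T r =
     (- 1) ^ r * Determinant.det (Matrix.mat k k (\<lambda>(i, j). B $$ (insert_index r i, pick T j)))"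

text \<open>The position \<open>p\<close> is left open so that the expansion serves both a repeated
  column in front and a column inserted in increasing order.\<close>

lemma minor_cofactor_expansion:
  fixes A B :: "'a :: field mat"
  assumes A: "A \<in> carrier_mat (Suc k) (Suc k)" and p: "p \<le> k"
    and Ap: "\<And>r. r \<le> k \<Longrightarrow> A $$ (r, p) = B $$ (r, c)"
    and Aj: "\<And>r j. r \<le> k \<Longrightarrow> j < k \<Longrightarrow> A $$ (r, insert_index p j) = B $$ (r, pick T j)"
  shows "Determinant.det A = (- 1) ^ p * (\<Sum>r<Suc k. minor_cofactor k B T r * B $$ (r, c))"
proof -
  have "cofactor A r p = (- 1) ^ p * minor_cofactor k B T r" if r: "r \<le> k" for r
  proof -
    have "mat_delete A r p = Matrix.mat k k (\<lambda>(i, j). B $$ (insert_index r i, pick T j))"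
    proof (rule eq_matI)
      fix i j assume "i < dim_row (Matrix.mat k k (\<lambda>(i, j). B $$ (insert_index r i, pick T j)))"
        "j < dim_col (Matrix.mat k k (\<lambda>(i, j). B $$ (insert_index r i, pick T j)))"
      then have ij: "i < k" "j < k" by simp_all
      then have "insert_index r i \<le> k" by (simp add: insert_index_def)
      then show "mat_delete A r p $$ (i, j) =
          Matrix.mat k k (\<lambda>(i, j). B $$ (insert_index r i, pick T j)) $$ (i, j)"
        using mat_delete_index[OF A _ _ ij, of r p] r p ij Aj by simp
    qed (use A in \<open>auto simp: mat_delete_def\<close>)
    then show ?thesis by (simp add: cofactor_def minor_cofactor_def power_add)
  qed
  then have "Determinant.det A = (\<Sum>r<Suc k. B $$ (r, c) * ((- 1) ^ p * minor_cofactor k B T r))"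
    unfolding laplace_expansion_column[OF A le_imp_less_Suc[OF p]]
    by (intro sum.cong) (simp_all add: Ap)
  then show ?thesis by (simp only: sum_distrib_left mult.commute mult.left_commute)
qed

text \<open>Laplace expansion along the column \<open>c\<close>; if \<open>c\<close> already belongs
  to \<open>T\<close>, the expanded determinant has two equal columns.\<close>

lemma minor_cofactor_combination:
  fixes B :: "'a :: field mat"
  assumes B: "B \<in> carrier_mat (Suc k) m" and T: "T \<subseteq> {..<m}" "card T = k" and c: "c < m"
  shows "(\<Sum>r<Suc k. minor_cofactor k B T r * B $$ (r, c)) =
    (if c \<in> T then 0
     else (- 1) ^ card {t \<in> T. t < c} * Determinant.det (submatrix B UNIV (insert c T)))"
proof (cases "c \<in> T")
  case True
  define A where "A = Matrix.mat (Suc k) (Suc k)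
    (\<lambda>(r, j). if j = 0 then B $$ (r, c) else B $$ (r, pick T (j - 1)))"
  define j where "j = card {t \<in> T. t < c}"
  have fin: "finite T" using T(1) by (rule finite_subset) simp
  have "{t \<in> T. t < c} \<subset> T" using True by blast
  then have j: "j < k" unfolding j_def T(2)[symmetric] by (rule psubset_card_mono[OF fin])
  have "pick T j = c" unfolding j_def using True by (rule pick_card_in_set)
  then have "col A 0 = col A (Suc j)" using j by (intro eq_vecI) (simp_all add: A_def)
  then have "Determinant.det A = 0"
    using j by (intro det_identical_cols[of A "Suc k" 0 "Suc j"]) (simp_all add: A_def)
  moreover have "Determinant.det A =
    (- 1) ^ 0 * (\<Sum>r<Suc k. minor_cofactor k B T r * B $$ (r, c))"
    by (rule minor_cofactor_expansion) (simp_all add: A_def insert_index_def)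
  ultimately show ?thesis using True by simp
next
  case False
  define p where "p = card {t \<in> T. t < c}"
  have fin: "finite T" using T(1) by (rule finite_subset) simp
  have "card {t \<in> T. t < c} \<le> card T" using fin by (intro card_mono) auto
  then have p: "p \<le> k" unfolding p_def T(2) .
  have "{j. j < m \<and> j \<in> insert c T} = insert c T" using T(1) c by auto
  then have cardc: "card {j. j < m \<and> j \<in> insert c T} = Suc k" using False fin T(2) by simp
  have dims: "submatrix B UNIV (insert c T) \<in> carrier_mat (Suc k) (Suc k)"
    using B cardc by (intro carrier_matI) (simp_all add: dim_submatrix)
  have idx: "submatrix B UNIV (insert c T) $$ (r, j) = B $$ (r, pick (insert c T) j)"
    if "r \<le> k" "j \<le> k" for r j
    using that B cardc by (subst submatrix_index) (simp_all add: pick_UNIV)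
  have "Determinant.det (submatrix B UNIV (insert c T)) =
    (- 1) ^ p * (\<Sum>r<Suc k. minor_cofactor k B T r * B $$ (r, c))"
  proof (rule minor_cofactor_expansion[OF dims p])
    show "submatrix B UNIV (insert c T) $$ (r, p) = B $$ (r, c)" if "r \<le> k" for r
      using idx[OF that p] pick_insert(1)[OF fin False] by (simp add: p_def)
    show "submatrix B UNIV (insert c T) $$ (r, insert_index p j) = B $$ (r, pick T j)"
      if "r \<le> k" "j < k" for r j
    proof -
      have "insert_index p j \<le> k" using that by (simp add: insert_index_def)
      then show ?thesis
        using idx[OF that(1)] pick_insert(2)[OF fin False, of j] that(2) T(2) by (simp add: p_def)
    qed
  qed
  then have "(- 1) ^ p * Determinant.det (submatrix B UNIV (insert c T)) =
    ((- 1) ^ p * (- 1) ^ p) * (\<Sum>r<Suc k. minor_cofactor k B T r * B $$ (r, c))"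
    by (simp only: mult.assoc)
  moreover have "(- 1) ^ p * (- 1) ^ p = (1 :: 'a)"
    by (simp add: power_mult_distrib[symmetric])
  ultimately show ?thesis using False by (simp add: p_def)
qed

text \<open>Induction on the number of rows. If the rows before the last have a nonzero maximal
  minor in columns \<open>T\<close>, the cofactors for \<open>T\<close> give a relation whose last
  coefficient is this minor up to sign; the relation holds because the larger minors vanish.\<close>

lemma rows_dependent_if_minors_zero:
  fixes B :: "'a :: field mat"
  assumes "B \<in> carrier_mat k m"
    and "\<And>J. J \<subseteq> {..<m} \<Longrightarrow> card J = k \<Longrightarrow> Determinant.det (submatrix B UNIV J) = 0"
  shows "\<exists>y. (\<exists>r<k. y r \<noteq> 0) \<and> (\<forall>c<m. (\<Sum>r<k. y r * B $$ (r, c)) = 0)"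
  using assms
proof (induction k arbitrary: B)
  case 0
  \<comment> \<open>Without rows the hypothesis fails, because the empty determinant is 1.\<close>
  have "submatrix B UNIV {} \<in> carrier_mat 0 0"
    using 0(1) by (intro carrier_matI) (simp_all add: dim_submatrix)
  then show ?case using 0(2)[of "{}"] det_dim_zero by fastforce
next
  case (Suc k)
  define B' where "B' = Matrix.mat k m (\<lambda>(r, c). B $$ (r, c))"
  have B': "B' \<in> carrier_mat k m" by (simp add: B'_def)
  show ?case
  proof (cases "\<forall>J. J \<subseteq> {..<m} \<longrightarrow> card J = k \<longrightarrow> Determinant.det (submatrix B' UNIV J) = 0")
    case True
    then obtain y where y: "\<exists>r<k. y r \<noteq> 0" "\<forall>c<m. (\<Sum>r<k. y r * B' $$ (r, c)) = 0"
      using Suc.IH[OF B'] by blast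
    obtain r where "r < k" "y r \<noteq> 0" using y(1) by blast
    moreover have "(\<Sum>r<Suc k. (y(k := 0)) r * B $$ (r, c)) = 0" if "c < m" for c
      using y(2) that by (simp add: B'_def)
    moreover have "\<exists>s<Suc k. (y(k := 0)) s \<noteq> 0" using calculation(1,2) by (intro exI[of _ r]) simp
    ultimately show ?thesis by blast
  next
    case False
    then obtain T where T: "T \<subseteq> {..<m}" "card T = k" "Determinant.det (submatrix B' UNIV T) \<noteq> 0"
      by blast
    have fin: "finite T" using T(1) by (rule finite_subset) simp
    have "{j. j < m \<and> j \<in> T} = T" using T(1) by auto
    moreover have "pick T j < m" if "j < k" for j
      using pick_in_set_le[of j T] that T(1,2) by auto
    ultimately have "submatrix B' UNIV T = Matrix.mat k k (\<lambda>(i, j). B $$ (insert_index k i, pick T j))"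
      using T(1,2)
      by (intro eq_matI) (auto simp: dim_submatrix submatrix_def pick_UNIV insert_index_def B'_def)
    then have "minor_cofactor k B T k \<noteq> 0" using T(3) by (simp add: minor_cofactor_def)
    moreover have "(\<Sum>r<Suc k. minor_cofactor k B T r * B $$ (r, c)) = 0" if "c < m" for c
    proof (cases "c \<in> T")
      case False
      then have "Determinant.det (submatrix B UNIV (insert c T)) = 0"
        using that T(1,2) fin by (intro Suc.prems(2)) auto
      then show ?thesis
        using minor_cofactor_combination[OF Suc.prems(1) T(1,2) that] by simp
    qed (simp only: minor_cofactor_combination[OF Suc.prems(1) T(1,2) that] if_True)
    ultimately show ?thesis by blast
  qed
qed

section \<open>Row spans, rank and change of the representing matrix\<close>

lemma mem_row_span_iff:
  assumes B: "B \<in> carrier_mat k m"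
  shows "w \<in> row_span m B \<longleftrightarrow> w \<in> carrier_vec m \<and>
    (\<exists>y. \<forall>c<m. vec_index w c = (\<Sum>r<k. y r * B $$ (r, c)))"
proof -
  have idx: "vec_index (B\<^sup>T *\<^sub>v v) c = (\<Sum>r<k. vec_index v r * B $$ (r, c))"
    if "v \<in> carrier_vec k" "c < m" for v c
    using that B by (simp add: scalar_prod_def atLeast0LessThan mult.commute)
  have "w \<in> row_span m B \<longleftrightarrow> w \<in> carrier_vec m \<and> (\<exists>v\<in>carrier_vec k. B\<^sup>T *\<^sub>v v = w)"
    using vec_space.row_space_eq[OF B] B by auto
  also have "\<dots> \<longleftrightarrow> w \<in> carrier_vec m \<and>
    (\<exists>y. \<forall>c<m. vec_index w c = (\<Sum>r<k. y r * B $$ (r, c)))"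
  proof (intro conj_cong refl iffI)
    assume "\<exists>v\<in>carrier_vec k. B\<^sup>T *\<^sub>v v = w"
    then obtain v where "v \<in> carrier_vec k" "B\<^sup>T *\<^sub>v v = w" by blast
    then show "\<exists>y. \<forall>c<m. vec_index w c = (\<Sum>r<k. y r * B $$ (r, c))"
      using idx by (intro exI[of _ "vec_index v"]) auto
  next
    assume w: "w \<in> carrier_vec m" and "\<exists>y. \<forall>c<m. vec_index w c = (\<Sum>r<k. y r * B $$ (r, c))"
    then obtain y where y: "\<forall>c<m. vec_index w c = (\<Sum>r<k. y r * B $$ (r, c))" by blast
    have "B\<^sup>T *\<^sub>v Matrix.vec k y = w"
    proof (rule eq_vecI)
      fix c assume "c < dim_vec w"
      then have "c < m" using w by simp
      then show "vec_index (B\<^sup>T *\<^sub>v Matrix.vec k y) c = vec_index w c"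
        using y by (simp add: idx)
    qed (use B w in simp)
    then show "\<exists>v\<in>carrier_vec k. B\<^sup>T *\<^sub>v v = w" by (intro bexI[of _ "Matrix.vec k y"]) auto
  qed
  finally show ?thesis .
qed

lemma Gr_rows_independent:
  assumes X: "X \<in> Gr k m" and B: "B \<in> carrier_mat k m" "row_span m B = X"
    and y: "\<forall>c<m. (\<Sum>r<k. y r * B $$ (r, c)) = 0" and r: "r < k"
  shows "y r = 0"
proof (rule ccontr)
  assume yr: "y r \<noteq> 0"
  interpret vec_space "TYPE(real)" m .
  have BT: "B\<^sup>T \<in> carrier_mat m k" using B by simp
  have rk: "rank B\<^sup>T = k"
    using X B(2) by (simp add: Gr_def rank_def row_space_def)
  \<comment> \<open>Linear dependence is a property of the set of columns, so a repeated column has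
    to be excluded first; it would make the rank smaller than \<open>k\<close>.\<close>
  have dist: "distinct (cols B\<^sup>T)"
  proof (rule ccontr)
    assume "\<not> distinct (cols B\<^sup>T)"
    then have less: "card (set (cols B\<^sup>T)) < k"
      using BT by (metis card_distinct card_length cols_length carrier_matD(2) le_neq_implies_less)
    obtain S where S: "maximal S (\<lambda>T. T \<subseteq> set (cols B\<^sup>T) \<and> lin_indpt T)"
      using maximal_exists[of "(\<lambda>T. T \<subseteq> set (cols B\<^sup>T) \<and> lin_indpt T)" "card (set (cols B\<^sup>T))" "{}"]
      by (meson List.finite_set card_mono empty_iff empty_subsetI finite_lin_indpt2 rev_finite_subset)
    then have "card S \<le> card (set (cols B\<^sup>T))" by (simp add: card_mono maximal_def)
    then show False using rank_card_indpt[OF BT S] rk less by simp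
  qed
  have "B\<^sup>T *\<^sub>v Matrix.vec k y = 0\<^sub>v m"
  proof (rule eq_vecI)
    fix c assume "c < dim_vec (0\<^sub>v m :: real Matrix.vec)"
    then have "c < m" by simp
    then show "vec_index (B\<^sup>T *\<^sub>v Matrix.vec k y) c = vec_index (0\<^sub>v m) c"
      using B y by (simp add: scalar_prod_def atLeast0LessThan mult.commute)
  qed (use B in simp)
  moreover have "Matrix.vec k y \<noteq> 0\<^sub>v k" using yr r by (metis index_vec index_zero_vec(1))
  ultimately have "lin_dep (set (cols B\<^sup>T))"
    using lin_depI[OF BT _ _ _ dist, of "Matrix.vec k y"] by simp
  then show False using full_rank_lin_indpt[OF BT rk dist] by simp
qed

lemma Gr_nonzero_minor:
  assumes "X \<in> Gr k m" "B \<in> carrier_mat k m" "row_span m B = X"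
  shows "\<exists>J\<subseteq>{..<m}. card J = k \<and> Determinant.det (submatrix B UNIV J) \<noteq> 0"
proof (rule ccontr)
  assume "\<not> ?thesis"
  then obtain y where "\<exists>r<k. y r \<noteq> 0" "\<forall>c<m. (\<Sum>r<k. y r * B $$ (r, c)) = 0"
    using rows_dependent_if_minors_zero[OF assms(2)] by blast
  then show False using Gr_rows_independent[OF assms] by blast
qed

lemma row_span_row:
  assumes B: "B \<in> carrier_mat k m" and r: "r < k"
  shows "Matrix.row B r \<in> row_span m B"
  unfolding mem_row_span_iff[OF B]
  using B r by (intro conjI exI[of _ "\<lambda>s. if s = r then 1 else 0"]) (auto simp: if_distrib[of "\<lambda>x. x * _"] cong: if_cong)

lemma factor_through_row_span:
  assumes N: "N \<in> carrier_mat k m" and B: "B \<in> carrier_mat k m"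
    and sub: "\<And>r. r < k \<Longrightarrow> Matrix.row N r \<in> row_span m B"
  obtains A where "A \<in> carrier_mat k k" "N = A * B"
proof -
  have "\<exists>y. \<forall>c<m. N $$ (r, c) = (\<Sum>s<k. y s * B $$ (s, c))" if "r < k" for r
    using sub[OF that] N that unfolding mem_row_span_iff[OF B] by auto
  then obtain y where y: "\<And>r c. r < k \<Longrightarrow> c < m \<Longrightarrow> N $$ (r, c) = (\<Sum>s<k. y r s * B $$ (s, c))"
    by metis
  have "N = Matrix.mat k k (\<lambda>(r, s). y r s) * B"
    using N B y by (intro eq_matI) (auto simp: scalar_prod_def atLeast0LessThan)
  then show thesis using that[of "Matrix.mat k k (\<lambda>(r, s). y r s)"] by simp
qed

text \<open>Row by row inclusion gives \<open>N = A * B\<close>, and the right inverse of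
  \<open>N\<close> makes \<open>A\<close> invertible, so the inclusion is an equality.\<close>

lemma row_span_eqI:
  assumes N: "N \<in> carrier_mat k m" and B: "B \<in> carrier_mat k m"
    and sub: "\<And>r. r < k \<Longrightarrow> Matrix.row N r \<in> row_span m B"
    and R: "R \<in> carrier_mat m k" "N * R = 1\<^sub>m k"
  shows "row_span m N = row_span m B"
proof -
  obtain A where A: "A \<in> carrier_mat k k" "N = A * B"
    using factor_through_row_span[OF N B sub] by blast
  have BR: "B * R \<in> carrier_mat k k" using B R by simp
  have AB: "A * (B * R) = 1\<^sub>m k" using A B R by (simp add: assoc_mult_mat)
  then have "invertible_mat A"
    using mat_mult_left_right_inverse[OF A(1) BR AB] A BR
    by (auto simp: invertible_mat_def inverts_mat_def square_mat.simps)
  then show ?thesis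
    using vec_space.row_space_is_preserved[OF _ A(1) B] A(2) by simp
qed

lemma det_submatrix_mult:
  fixes A B :: "'a :: field mat"
  assumes A: "A \<in> carrier_mat k k" and B: "B \<in> carrier_mat k m" and J: "J \<subseteq> {..<m}" "card J = k"
  shows "Determinant.det (submatrix (A * B) UNIV J) =
    Determinant.det A * Determinant.det (submatrix B UNIV J)"
proof -
  have "{j. j < m \<and> j \<in> J} = J" using J by auto
  then have card: "card {j. j < m \<and> j \<in> J} = k" using J by simp
  have pick: "pick J j < m" if "j < k" for j
    using pick_in_set_le[of j J] that J by auto
  have S: "submatrix B UNIV J \<in> carrier_mat k k"
    using B card by (intro carrier_matI) (simp_all add: dim_submatrix)
  have "submatrix (A * B) UNIV J = A * submatrix B UNIV J"
    using A B card pick S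
    by (intro eq_matI) (auto simp: dim_submatrix submatrix_def pick_UNIV scalar_prod_def)
  then show ?thesis by (simp add: det_mult[OF A S])
qed

section \<open>The points given by a matrix S\<close>

lemma pos_neq_tpos: "pos i \<noteq> tpos j"
  unfolding pos_def tpos_def by presburger

lemma submatrix_card:
  assumes "I \<subseteq> {..<n}" "J \<subseteq> {..<n}"
  shows "card (pos ` I \<union> tpos ` J) = card I + card J" "pos ` I \<union> tpos ` J \<subseteq> {..<2 * n}"
proof -
  have "pos ` I \<inter> tpos ` J = {}" using pos_neq_tpos by blast
  moreover have "finite I" "finite J" using assms finite_subset by blast+
  moreover have "inj_on pos I" "inj_on tpos J" by (auto simp: inj_on_def pos_def tpos_def)
  ultimately show "card (pos ` I \<union> tpos ` J) = card I + card J"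
    by (simp add: card_Un_disjoint card_image)
  show "pos ` I \<union> tpos ` J \<subseteq> {..<2 * n}"
    using assms by (auto simp: pos_def tpos_def)
qed

lemma index_cases:
  assumes "c < 2 * n"
  obtains i where "i < n" "c = pos i" | i where "i < n" "c = tpos i"
proof (cases "even c")
  case True
  then show thesis using that(1)[of "c div 2"] assms by (simp add: pos_def)
next
  case False
  then show thesis using that(2)[of "c div 2"] assms by (simp add: tpos_def)
qed

lemma index_union: "J \<subseteq> {..<2 * n} \<Longrightarrow> J = pos ` {i. i < n \<and> pos i \<in> J} \<union> tpos ` {i. i < n \<and> tpos i \<in> J}"
proof (intro equalityI subsetI)
  fix c assume J: "J \<subseteq> {..<2 * n}" and c: "c \<in> J"
  then have "c < 2 * n" by auto
  then show "c \<in> pos ` {i. i < n \<and> pos i \<in> J} \<union> tpos ` {i. i < n \<and> tpos i \<in> J}"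
    using c by (cases rule: index_cases) auto
qed (use pos_neq_tpos in blast)

lemma position_simps [simp]:
  "pos i < 2 * n \<longleftrightarrow> i < n" "tpos i < 2 * n \<longleftrightarrow> i < n"
  "pos i = pos j \<longleftrightarrow> i = j" "tpos i = tpos j \<longleftrightarrow> i = j"
  "pos i \<noteq> tpos j" "tpos j \<noteq> pos i"
  "pos i < pos j \<longleftrightarrow> i < j" "tpos i < tpos j \<longleftrightarrow> i < j"
  "pos i < tpos j \<longleftrightarrow> i \<le> j" "tpos i < pos j \<longleftrightarrow> i < j"
  using pos_neq_tpos[of i j] by (auto simp: pos_def tpos_def)

section \<open>The rows of the product of M and D, and their span\<close>

lemma MD_carrier: "M_mat n S * D_mat n \<in> carrier_mat (n + 1) (2 * n)"
  unfolding M_mat_def D_mat_def by (rule mult_carrier_mat[of _ _ "2 * n"]) auto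

lemma MD_index:
  assumes "r \<le> n" "c < 2 * n"
  shows "(M_mat n S * D_mat n) $$ (r, c) = M_mat n S $$ (r, c) * (- 1) ^ (c div 2)"
proof -
  have "M_mat n S \<in> carrier_mat (n + 1) (2 * n)" by (simp add: M_mat_def)
  then show ?thesis using assms unfolding D_mat_def
    by (subst mat_diag_mult_right) (auto simp: M_mat_def)
qed

lemma MD_entries:
  shows "i < n \<Longrightarrow> (M_mat n S * D_mat n) $$ (0, pos i) = 0"
    and "k < n \<Longrightarrow> (M_mat n S * D_mat n) $$ (0, tpos k) = (- 1) ^ k"
    and "i < n \<Longrightarrow> j < n \<Longrightarrow> (M_mat n S * D_mat n) $$ (Suc i, pos j) = (if j = i then (- 1) ^ i else 0)"
    and "i < n \<Longrightarrow> k < n \<Longrightarrow> (M_mat n S * D_mat n) $$ (Suc i, tpos k) = (- 1) ^ k * S $$ (i, k)"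
proof -
  have M: "M_mat n S $$ (r, c) = (if r = 0 then (if even c then 0 else 1)
     else (if even c then (if c = pos (r - 1) then 1 else 0) else S $$ (r - 1, c div 2)))"
    if "r \<le> n" "c < 2 * n" for r c using that by (simp add: M_mat_def)
  show "i < n \<Longrightarrow> (M_mat n S * D_mat n) $$ (0, pos i) = 0"
    by (simp add: MD_index M) (simp add: pos_def)
  show "k < n \<Longrightarrow> (M_mat n S * D_mat n) $$ (0, tpos k) = (- 1) ^ k"
    by (simp add: MD_index M) (simp add: tpos_def)
  show "i < n \<Longrightarrow> j < n \<Longrightarrow> (M_mat n S * D_mat n) $$ (Suc i, pos j) = (if j = i then (- 1) ^ i else 0)"
    by (simp add: MD_index M) (simp add: pos_def)
  show "i < n \<Longrightarrow> k < n \<Longrightarrow> (M_mat n S * D_mat n) $$ (Suc i, tpos k) = (- 1) ^ k * S $$ (i, k)"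
    by (simp add: MD_index M) (simp add: tpos_def)
qed

text \<open>Here \<open>\<alpha>\<close> is the coefficient of the first row and \<open>a i\<close>
  that of the row belonging to \<open>i\<close>; the latter can be read off at
  \<open>pos i\<close>.\<close>

lemma mem_row_span_MD_iff:
  "x \<in> row_span (2 * n) (M_mat n S * D_mat n) \<longleftrightarrow> x \<in> carrier_vec (2 * n) \<and>
    (\<exists>\<alpha> a. (\<forall>i<n. vec_index x (pos i) = (- 1) ^ i * a i) \<and>
      (\<forall>k<n. vec_index x (tpos k) = (- 1) ^ k * (\<alpha> + (\<Sum>i<n. a i * S $$ (i, k)))))"
    (is "_ \<longleftrightarrow> _ \<and> (\<exists>\<alpha> a. ?P \<alpha> a)")
proof -
  let ?N = "M_mat n S * D_mat n"
  have p: "(\<Sum>r<n + 1. y r * ?N $$ (r, pos i)) = (- 1) ^ i * y (Suc i)" if "i < n" for y i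
  proof -
    have "(\<Sum>r<n + 1. y r * ?N $$ (r, pos i)) = (\<Sum>j<n. if i = j then (- 1) ^ j * y (Suc j) else 0)"
      unfolding Suc_eq_plus1[symmetric] sum.lessThan_Suc_shift
      using that by (simp add: MD_entries if_distrib[of "\<lambda>x. _ * x"] cong: if_cong)
    then show ?thesis using that by simp
  qed
  have t: "(\<Sum>r<n + 1. y r * ?N $$ (r, tpos k)) =
      (- 1) ^ k * (y 0 + (\<Sum>i<n. y (Suc i) * S $$ (i, k)))" if "k < n" for y k
    unfolding Suc_eq_plus1[symmetric] sum.lessThan_Suc_shift
    using that by (simp add: MD_entries distrib_left sum_distrib_left mult.left_commute mult.commute)
  have "(\<forall>c<2 * n. vec_index x c = (\<Sum>r<n + 1. y r * ?N $$ (r, c))) \<longleftrightarrow>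
      ?P (y 0) (\<lambda>i. y (Suc i))" for y
  proof
    assume "\<forall>c<2 * n. vec_index x c = (\<Sum>r<n + 1. y r * ?N $$ (r, c))"
    then show "?P (y 0) (\<lambda>i. y (Suc i))" using p t by simp
  next
    assume P: "?P (y 0) (\<lambda>i. y (Suc i))"
    show "\<forall>c<2 * n. vec_index x c = (\<Sum>r<n + 1. y r * ?N $$ (r, c))"
    proof (intro allI impI)
      fix c assume "c < 2 * n"
      then show "vec_index x c = (\<Sum>r<n + 1. y r * ?N $$ (r, c))"
        by (cases rule: index_cases) (use P p t in auto)
    qed
  qed
  then have "x \<in> row_span (2 * n) ?N \<longleftrightarrow> x \<in> carrier_vec (2 * n) \<and> (\<exists>y. ?P (y 0) (\<lambda>i. y (Suc i)))"
    unfolding mem_row_span_iff[OF MD_carrier] by simp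
  also have "(\<exists>y. ?P (y 0) (\<lambda>i. y (Suc i))) \<longleftrightarrow> (\<exists>\<alpha> a. ?P \<alpha> a)"
  proof
    assume "\<exists>\<alpha> a. ?P \<alpha> a"
    then obtain \<alpha> a where "?P \<alpha> a" by (elim exE)
    then show "\<exists>y. ?P (y 0) (\<lambda>i. y (Suc i))"
      by (intro exI[of _ "case_nat \<alpha> a"]) simp
  next
    assume "\<exists>y. ?P (y 0) (\<lambda>i. y (Suc i))"
    then obtain y where "?P (y 0) (\<lambda>i. y (Suc i))" ..
    then show "\<exists>\<alpha> a. ?P \<alpha> a" by (intro exI)
  qed
  finally show ?thesis .
qed

text \<open>The last pair in \<open>Omega\<close> closes the chain of neighbouring labels to a
  cycle.\<close>

lemma cyclic_sum:
  assumes "0 < (n :: nat)"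
  shows "(\<Sum>j<n - 1. f (j + 1) j) + f 0 (n - 1) = (\<Sum>i<n. f i ((i + n - 1) mod n) :: real)"
proof -
  obtain m where m: "n = Suc m" using assms gr0_implies_Suc by blast
  have "(Suc j + m) mod Suc m = j" if "j < m" for j
    using that by (simp add: mod_if)
  then show ?thesis
    unfolding m by (simp add: sum.lessThan_Suc_shift del: sum.lessThan_Suc)
qed

text \<open>The signs of \<open>D_mat\<close> give all terms between cyclic neighbours a minus sign.
  Summation leaves differences of adjacent columns of \<open>S\<close>, in which
  \<open>\<alpha>\<close> and \<open>\<beta>\<close> cancel, and \<open>Omega\<close> becomes the
  antisymmetrization of the bilinear form of \<open>P_mat\<close>.\<close>

lemma row_span_MD_isotropic:
  assumes n: "0 < n" and sym: "(P_mat n S)\<^sup>T = P_mat n S"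
    and x: "x \<in> row_span (2 * n) (M_mat n S * D_mat n)"
    and y: "y \<in> row_span (2 * n) (M_mat n S * D_mat n)"
  shows "Omega n x y = 0"
proof -
  obtain \<alpha> a where x: "\<And>i. i < n \<Longrightarrow> vec_index x (pos i) = (- 1) ^ i * a i"
    "\<And>k. k < n \<Longrightarrow> vec_index x (tpos k) = (- 1) ^ k * (\<alpha> + (\<Sum>i<n. a i * S $$ (i, k)))"
    using x unfolding mem_row_span_MD_iff by blast
  obtain \<beta> b where y: "\<And>i. i < n \<Longrightarrow> vec_index y (pos i) = (- 1) ^ i * b i"
    "\<And>k. k < n \<Longrightarrow> vec_index y (tpos k) = (- 1) ^ k * (\<beta> + (\<Sum>i<n. b i * S $$ (i, k)))"
    using y unfolding mem_row_span_MD_iff by blast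
  define A where "A k = \<alpha> + (\<Sum>i<n. a i * S $$ (i, k))" for k
  define B where "B k = \<beta> + (\<Sum>i<n. b i * S $$ (i, k))" for k
  let ?p = "\<lambda>i. (i + n - 1) mod n"
  have P: "P_mat n S $$ (i, l) = S $$ (l, ?p i) - S $$ (l, i)" if "i < n" "l < n" for i l
    using that by (simp add: P_mat_def)
  have sq: "(- 1) ^ i * u * ((- 1) ^ i * v) = u * (v :: real)" for i :: nat and u v
  proof -
    have "(- 1 :: real) ^ i * (- 1) ^ i = 1" by (simp add: power_mult_distrib[symmetric])
    then show ?thesis by (metis mult.assoc mult.left_commute mult_1)
  qed
  have t1: "(\<Sum>i<n. vec_index x (pos i) * vec_index y (tpos i)
      - vec_index x (tpos i) * vec_index y (pos i)) = (\<Sum>i<n. a i * B i - A i * b i)"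
    by (rule sum.cong) (simp_all add: x y A_def B_def sq)
  have t2: "(\<Sum>j<n - 1. vec_index x (pos (j + 1)) * vec_index y (tpos j)
      - vec_index x (tpos j) * vec_index y (pos (j + 1))) =
    (\<Sum>j<n - 1. - (a (j + 1) * B j - A j * b (j + 1)))"
  proof (rule sum.cong[OF refl])
    fix j assume "j \<in> {..<n - 1}"
    then have j: "j < n" "j + 1 < n" by auto
    have "vec_index x (pos (j + 1)) * vec_index y (tpos j) = - ((- 1) ^ j * a (j + 1) * ((- 1) ^ j * B j))"
      "vec_index x (tpos j) * vec_index y (pos (j + 1)) = - ((- 1) ^ j * A j * ((- 1) ^ j * b (j + 1)))"
      using x[OF j(2)] x(2)[OF j(1)] y[OF j(2)] y(2)[OF j(1)] by (simp_all add: A_def B_def)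
    then show "vec_index x (pos (j + 1)) * vec_index y (tpos j)
      - vec_index x (tpos j) * vec_index y (pos (j + 1)) = - (a (j + 1) * B j - A j * b (j + 1))"
      unfolding sq by simp
  qed
  have t3: "(- 1) ^ n * (vec_index x (pos 0) * vec_index y (tpos (n - 1))
      - vec_index x (tpos (n - 1)) * vec_index y (pos 0)) = - (a 0 * B (n - 1) - A (n - 1) * b 0)"
  proof -
    \<comment> \<open>The factor \<open>(- 1) ^ n\<close> gives the closing pair the same minus sign
      as the neighbouring pairs in \<open>t2\<close>.\<close>
    have m: "(- 1) ^ n = - ((- 1 :: real) ^ (n - 1))" using n by (cases n) auto
    have "vec_index x (pos 0) = a 0" "vec_index y (pos 0) = b 0"
      "vec_index x (tpos (n - 1)) = (- 1) ^ (n - 1) * A (n - 1)"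
      "vec_index y (tpos (n - 1)) = (- 1) ^ (n - 1) * B (n - 1)"
      using x[of 0] y[of 0] x(2)[of "n - 1"] y(2)[of "n - 1"] n by (simp_all add: A_def B_def)
    then show ?thesis
      unfolding m using sq[of "n - 1" 1 "a 0 * B (n - 1) - A (n - 1) * b 0"]
      by (simp add: algebra_simps)
  qed
  have "Omega n x y = (\<Sum>i<n. a i * B i - A i * b i) +
      ((\<Sum>j<n - 1. - (a (j + 1) * B j - A j * b (j + 1))) + - (a 0 * B (n - 1) - A (n - 1) * b 0))"
    unfolding Omega_def t1 t2 t3 by simp
  also have "\<dots> = (\<Sum>i<n. a i * B i - A i * b i) + (\<Sum>i<n. - (a i * B (?p i) - A (?p i) * b i))"
    using cyclic_sum[OF n, of "\<lambda>i k. - (a i * B k - A k * b i)"] by simp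
  also have "\<dots> = (\<Sum>i<n. b i * (A (?p i) - A i)) - (\<Sum>i<n. a i * (B (?p i) - B i))"
    by (simp add: sum.distrib[symmetric] sum_subtractf[symmetric] algebra_simps)
  also have "(\<Sum>i<n. b i * (A (?p i) - A i)) = (\<Sum>i<n. \<Sum>l<n. b i * a l * P_mat n S $$ (i, l))"
    by (rule sum.cong[OF refl])
      (simp add: A_def P sum_subtractf[symmetric] sum_distrib_left algebra_simps)
  also have "\<dots> = (\<Sum>l<n. \<Sum>i<n. b i * a l * P_mat n S $$ (i, l))" by (rule sum.swap)
  also have "\<dots> = (\<Sum>l<n. \<Sum>i<n. a l * b i * P_mat n S $$ (l, i))"
  proof (intro sum.cong refl)
    fix l i assume "l \<in> {..<n}" "i \<in> {..<n}"
    then have "(P_mat n S)\<^sup>T $$ (l, i) = P_mat n S $$ (i, l)" by (simp add: P_mat_def)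
    then show "b i * a l * P_mat n S $$ (i, l) = a l * b i * P_mat n S $$ (l, i)"
      unfolding sym by simp
  qed
  also have "\<dots> = (\<Sum>i<n. a i * (B (?p i) - B i))"
    by (rule sum.cong[OF refl])
      (simp add: B_def P sum_subtractf[symmetric] sum_distrib_left algebra_simps)
  finally show ?thesis by simp
qed

text \<open>The entries at the positions \<open>pos j\<close> leave only multiples of the first row
  free, so each row of \<open>S\<close> is determined up to an additive constant, which the
  differences in \<open>P_mat\<close> remove.\<close>

lemma P_mat_unique:
  assumes n: "0 < n"
    and eq: "row_span (2 * n) (M_mat n S * D_mat n) = row_span (2 * n) (M_mat n S' * D_mat n)"
  shows "P_mat n S = P_mat n S'"
proof -
  have "\<exists>\<alpha>. \<forall>k<n. S $$ (i, k) = \<alpha> + S' $$ (i, k)" if i: "i < n" for i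
  proof -
    let ?N = "M_mat n S * D_mat n"
    have "Matrix.row ?N (Suc i) \<in> row_span (2 * n) (M_mat n S' * D_mat n)"
      unfolding eq[symmetric] using i by (intro row_span_row[OF MD_carrier]) simp
    moreover have "vec_index (Matrix.row ?N (Suc i)) c = ?N $$ (Suc i, c)" if "c < 2 * n" for c
    proof (rule index_row(1))
      show "Suc i < dim_row ?N" "c < dim_col ?N"
        using that i carrier_matD[OF MD_carrier[of n S]] by linarith+
    qed
    ultimately obtain \<alpha> a where a: "\<And>j. j < n \<Longrightarrow> ?N $$ (Suc i, pos j) = (- 1) ^ j * a j"
      and \<alpha>: "\<And>k. k < n \<Longrightarrow> ?N $$ (Suc i, tpos k) = (- 1) ^ k * (\<alpha> + (\<Sum>j<n. a j * S' $$ (j, k)))"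
      unfolding mem_row_span_MD_iff by auto
    have "a j = (if j = i then 1 else 0)" if j: "j < n" for j
    proof -
      have "(- 1) ^ j * a j = (if j = i then (- 1) ^ i else 0)"
        using a[OF j] MD_entries(3)[OF i j, of S] by (rule trans[OF sym])
      then show ?thesis by (cases "j = i") simp_all
    qed
    then have "(\<Sum>j<n. a j * S' $$ (j, k)) = (\<Sum>j<n. if j = i then S' $$ (j, k) else 0)" for k
      by (intro sum.cong) auto
    then have "(\<Sum>j<n. a j * S' $$ (j, k)) = S' $$ (i, k)" for k
      using i by simp
    then show ?thesis using \<alpha> MD_entries(4)[OF i, of _ S] by (intro exI[of _ \<alpha>]) simp
  qed
  then show ?thesis
    using n by (intro eq_matI) (auto simp: P_mat_def, fastforce)
qed

text \<open>The additive constant in each row is chosen to make the last column zero, which fits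
  Plucker coordinates that contain the last tilde label.\<close>

definition response_to_S :: "nat \<Rightarrow> real mat \<Rightarrow> real mat" where
  "response_to_S n L = Matrix.mat n n (\<lambda>(i, k). \<Sum>j\<in>{k<..<n}. L $$ (i, j))"

text \<open>Neighbouring tail sums differ by a single entry of \<open>L\<close>. Symmetry enters
  because the entry of \<open>P_mat\<close> at \<open>(a, b)\<close> is taken from row
  \<open>b\<close> of \<open>S\<close>.\<close>

lemma P_mat_response_to_S:
  assumes L: "L \<in> carrier_mat n n"
    and row_sum: "\<And>i. i < n \<Longrightarrow> (\<Sum>j<n. L $$ (i, j)) = 0"
    and sym: "\<And>i j. i < n \<Longrightarrow> j < n \<Longrightarrow> L $$ (i, j) = L $$ (j, i)"
  shows "P_mat n (response_to_S n L) = L"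
proof (rule eq_matI)
  fix a b assume "a < dim_row L" "b < dim_col L"
  then have ab: "a < n" "b < n" using L by auto
  have "(\<Sum>j\<in>{(a + n - 1) mod n<..<n}. L $$ (b, j)) = (\<Sum>j\<in>{a<..<n}. L $$ (b, j)) + L $$ (b, a)"
  proof (cases a)
    case 0
    \<comment> \<open>The cyclic predecessor of 0 is \<open>n - 1\<close>, whose tail sum is empty;
      the zero row sum replaces the telescoping here.\<close>
    have "{..<n} = insert 0 {0<..<n}" using ab by auto
    then have "L $$ (b, 0) + (\<Sum>j\<in>{0<..<n}. L $$ (b, j)) = 0"
      using row_sum[OF ab(2)] by simp
    moreover have "(0 + n - 1) mod n = n - 1" "{n - 1<..<n} = {}" using ab by auto
    ultimately show ?thesis using 0 by simp
  next
    case (Suc a')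
    have "(a + n - 1) mod n = a'" using ab Suc by (simp add: mod_if)
    moreover have "{a'<..<n} = insert a {a<..<n}" using ab Suc by auto
    ultimately show ?thesis by simp
  qed
  then show "P_mat n (response_to_S n L) $$ (a, b) = L $$ (a, b)"
    using ab sym[of a b] by (simp add: P_mat_def response_to_S_def)
qed (use L in \<open>auto simp: P_mat_def\<close>)

lemma minor_vector_in_row_span:
  assumes B: "B \<in> carrier_mat (Suc k) m" and T: "T \<subseteq> {..<m}" "card T = k"
  shows "Matrix.vec m (\<lambda>c. if c \<in> T then 0 else
      s * ((- 1) ^ card {t \<in> T. t < c} * Determinant.det (submatrix B UNIV (insert c T)))) \<in> row_span m B"
proof -
  have "(if c \<in> T then 0 else
      s * ((- 1) ^ card {t \<in> T. t < c} * Determinant.det (submatrix B UNIV (insert c T)))) =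
    (\<Sum>r<Suc k. s * minor_cofactor k B T r * B $$ (r, c))" if "c < m" for c
  proof -
    have "(\<Sum>r<Suc k. s * minor_cofactor k B T r * B $$ (r, c)) =
      s * (\<Sum>r<Suc k. minor_cofactor k B T r * B $$ (r, c))"
      by (simp only: sum_distrib_left mult.assoc)
    then show ?thesis unfolding minor_cofactor_combination[OF B T that] by simp
  qed
  then show ?thesis
    unfolding mem_row_span_iff[OF B] by (intro conjI exI[of _ "\<lambda>r. s * minor_cofactor k B T r"]) simp_all
qed

text \<open>When the last column of \<open>S\<close> vanishes, the last tilde column of
  \<open>M_mat\<close> followed by its \<open>pos\<close> columns is an identity matrix. The matrix
  \<open>R\<close> selects these columns and undoes the signs of \<open>D_mat\<close>.\<close>

lemma MD_right_inverse:
  assumes n: "0 < n" and S: "\<And>i. i < n \<Longrightarrow> S $$ (i, n - 1) = 0"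
  obtains R where "R \<in> carrier_mat (2 * n) (n + 1)" "M_mat n S * D_mat n * R = 1\<^sub>m (n + 1)"
proof -
  let ?N = "M_mat n S * D_mat n"
  define p where "p s = (if s = 0 then tpos (n - 1) else pos (s - 1))" for s
  define R :: "real mat" where
    "R = Matrix.mat (2 * n) (n + 1) (\<lambda>(c, s). if c = p s then (- 1) ^ (p s div 2) else 0)"
  have p: "p s < 2 * n" if "s \<le> n" for s using that n by (auto simp: p_def)
  have "?N * R = 1\<^sub>m (n + 1)"
  proof (rule eq_matI)
    fix r s assume "r < dim_row (1\<^sub>m (n + 1) :: real mat)" "s < dim_col (1\<^sub>m (n + 1) :: real mat)"
    then have rs: "r \<le> n" "s \<le> n" by simp_all
    have "(?N * R) $$ (r, s) = (\<Sum>c<2 * n. ?N $$ (r, c) * R $$ (c, s))"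
      using rs carrier_matD[OF MD_carrier[of n S]]
      by (subst index_mult_mat(1)) (auto simp: R_def scalar_prod_def atLeast0LessThan intro!: sum.cong)
    also have "\<dots> = (\<Sum>c<2 * n. if c = p s then ?N $$ (r, c) * (- 1) ^ (p s div 2) else 0)"
      using rs by (intro sum.cong) (auto simp: R_def)
    also have "\<dots> = ?N $$ (r, p s) * (- 1) ^ (p s div 2)" using p[OF rs(2)] by simp
    also have "\<dots> = M_mat n S $$ (r, p s) * ((- 1) ^ (p s div 2) * (- 1) ^ (p s div 2))"
      unfolding MD_index[OF rs(1) p[OF rs(2)]] by (simp only: mult.assoc)
    also have "\<dots> = M_mat n S $$ (r, p s)"
      by (simp add: power_mult_distrib[symmetric])
    also have "\<dots> = 1\<^sub>m (n + 1) $$ (r, s)"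
    proof (cases "s = 0")
      case True
      then have "p s = 2 * (n - 1) + 1" "p s < 2 * n" using n p[of 0] by (simp_all add: p_def tpos_def)
      then show ?thesis using rs True S[of "r - 1"] by (simp add: M_mat_def)
    next
      case False
      then have "p s = pos (s - 1)" "p s < 2 * n" using rs p[of s] by (simp_all add: p_def)
      moreover have "pos (s - 1) = pos (r - 1) \<longleftrightarrow> r = s" if "r \<noteq> 0"
        using that False by (auto simp: pos_def)
      ultimately show ?thesis using rs False by (auto simp: M_mat_def) (auto simp: pos_def)
    qed
    finally show "(?N * R) $$ (r, s) = 1\<^sub>m (n + 1) $$ (r, s)" .
  qed (use carrier_matD[OF MD_carrier[of n S]] in \<open>simp_all add: R_def\<close>)
  then show thesis using that[of R] by (simp add: R_def)
qed

text \<open>Each row is matched entry by entry with a scaled vector of signed minors of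
  \<open>B\<close>, and the right inverse turns this inclusion of row spans into equality.\<close>

lemma row_span_response_to_S:
  assumes n: "0 < n" and B: "B \<in> carrier_mat (n + 1) (2 * n)" and z: "z \<noteq> 0"
    and full: "\<And>k. k < n \<Longrightarrow> minor B {..<n} {k} = z"
    and omit: "\<And>i k. i < n \<Longrightarrow> k < n - 1 \<Longrightarrow> minor B ({..<n} - {i}) {k, n - 1} =
      z * (\<Sum>j\<in>{..<n} - {i}. if k \<in> {min i j..<max i j} then L $$ (i, j) else 0)"
    and row_sum: "\<And>i. i < n \<Longrightarrow> (\<Sum>j<n. L $$ (i, j)) = 0"
  shows "row_span (2 * n) (M_mat n (response_to_S n L) * D_mat n) = row_span (2 * n) B"
proof -
  let ?S = "response_to_S n L"
  define N where "N = M_mat n ?S * D_mat n"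
  note B' = B[unfolded Suc_eq_plus1[symmetric]]
  have N: "N \<in> carrier_mat (n + 1) (2 * n)" unfolding N_def by (rule MD_carrier)
  note dims = carrier_matD[OF N]
  note entries = MD_entries[where n = n and S = ?S, folded N_def]
  have inj: "inj_on pos A" for A by (simp add: inj_on_def)
  have "?S $$ (i, n - 1) = 0" if "i < n" for i
  proof -
    have "{n - 1<..<n} = {}" by auto
    then show ?thesis using that n by (simp add: response_to_S_def)
  qed
  then obtain R where R: "R \<in> carrier_mat (2 * n) (n + 1)" "N * R = 1\<^sub>m (n + 1)"
    using MD_right_inverse[OF n, of ?S] unfolding N_def by blast
  have row0: "Matrix.row N 0 \<in> row_span (2 * n) B"
  proof -
    define T where "T = pos ` {..<n}"
    have T: "T \<subseteq> {..<2 * n}" "card T = n" by (auto simp: T_def card_image[OF inj])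
    \<comment> \<open>There are \<open>k + 1\<close> elements of \<open>T\<close> before
      \<open>tpos k\<close>, whereas the entry of the row is \<open>(- 1) ^ k\<close>; hence the
      minus sign in the scalar.\<close>
    let ?w = "Matrix.vec (2 * n) (\<lambda>c. if c \<in> T then 0 else
      (- 1 / z) * ((- 1) ^ card {t \<in> T. t < c} * Determinant.det (submatrix B UNIV (insert c T))))"
    have "Matrix.row N 0 = ?w"
    proof (rule eq_vecI)
      fix c assume "c < dim_vec ?w"
      then have c: "c < 2 * n" by simp
      then show "vec_index (Matrix.row N 0) c = vec_index ?w c"
      proof (cases rule: index_cases)
        case (1 i)
        then show ?thesis using dims c by (simp add: entries T_def)
      next
        case (2 k)
        have "{t \<in> T. t < tpos k} = pos ` {..k}" using 2 by (auto simp: T_def)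
        then have "card {t \<in> T. t < tpos k} = Suc k" by (simp add: card_image[OF inj])
        moreover have "tpos k \<notin> T" by (auto simp: T_def)
        moreover have "insert (tpos k) T = pos ` {..<n} \<union> tpos ` {k}" by (simp add: T_def)
        then have "Determinant.det (submatrix B UNIV (insert (tpos k) T)) = z"
          using full[OF 2(1)] by (simp only: minor_def)
        ultimately show ?thesis using dims c 2 z by (simp add: entries)
      qed
    qed (use dims in simp)
    then show ?thesis using minor_vector_in_row_span[OF B' T] by simp
  qed
  have rowi: "Matrix.row N (Suc i) \<in> row_span (2 * n) B" if i: "i < n" for i
  proof -
    define T where "T = insert (tpos (n - 1)) (pos ` ({..<n} - {i}))"
    have nT: "tpos k \<in> T \<longleftrightarrow> k = n - 1" "pos j \<in> T \<longleftrightarrow> j < n \<and> j \<noteq> i" for j k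
      by (auto simp: T_def)
    have "tpos (n - 1) \<notin> pos ` ({..<n} - {i})" by auto
    then have T: "T \<subseteq> {..<2 * n}" "card T = n" using i by (auto simp: T_def card_image[OF inj])
    let ?w = "Matrix.vec (2 * n) (\<lambda>c. if c \<in> T then 0 else
      (1 / z) * ((- 1) ^ card {t \<in> T. t < c} * Determinant.det (submatrix B UNIV (insert c T))))"
    have "Matrix.row N (Suc i) = ?w"
    proof (rule eq_vecI)
      fix c assume "c < dim_vec ?w"
      then have c: "c < 2 * n" by simp
      have row: "vec_index (Matrix.row N (Suc i)) c = N $$ (Suc i, c)"
        using dims c i by (intro index_row(1)) linarith+
      from c show "vec_index (Matrix.row N (Suc i)) c = vec_index ?w c"
      proof (cases rule: index_cases)
        case (1 j)
        show ?thesis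
        proof (cases "j = i")
          case True
          have "{t \<in> T. t < pos i} = pos ` {..<i}" using i by (auto simp: T_def)
          then have "card {t \<in> T. t < pos i} = i" by (simp add: card_image[OF inj])
          moreover have "insert (pos i) T = pos ` {..<n} \<union> tpos ` {n - 1}" using i by (auto simp: T_def)
          then have "Determinant.det (submatrix B UNIV (insert (pos i) T)) = z"
            using full[of "n - 1"] n by (simp add: minor_def)
          ultimately show ?thesis using row c 1 True z i by (simp add: entries nT)
        next
          case False
          then show ?thesis using row c 1 i by (simp add: entries nT)
        qed
      next
        case (2 k)
        have Nk: "N $$ (Suc i, c) = (- 1) ^ k * (\<Sum>j\<in>{k<..<n}. L $$ (i, j))"
          using 2 i by (simp add: entries response_to_S_def)
        show ?thesis
        proof (cases "k = n - 1")
          case True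
          then have "{k<..<n} = {}" by auto
          then show ?thesis using row Nk c 2 True by (simp add: nT)
        next
          case False
          then have k: "k < n - 1" using 2 by auto
          have "{t \<in> T. t < tpos k} = pos ` ({..k} - {i})"
            using k by (auto simp: T_def)
          \<comment> \<open>The missing label \<open>i\<close> lowers the count by one exactly when
            \<open>i \<le> k\<close>.\<close>
          then have card: "card {t \<in> T. t < tpos k} = (if i \<le> k then k else Suc k)"
            by (simp add: card_image[OF inj])
          have "insert (tpos k) T = pos ` ({..<n} - {i}) \<union> tpos ` {k, n - 1}" by (auto simp: T_def)
          then have det: "Determinant.det (submatrix B UNIV (insert (tpos k) T)) =
            z * (\<Sum>j\<in>{..<n} - {i}. if k \<in> {min i j..<max i j} then L $$ (i, j) else 0)"
            using omit[OF i k] by (simp only: minor_def)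
          \<comment> \<open>For \<open>i > k\<close> the interval condition selects
            \<open>j \<le> k\<close>, and the zero row sum turns this part into minus the tail sum.
            The sign compensates the one coming from \<open>card\<close>.\<close>
          have eq: "(\<Sum>j\<in>{..<n} - {i}. if k \<in> {min i j..<max i j} then L $$ (i, j) else 0) =
            (if i \<le> k then \<Sum>j\<in>{k<..<n}. L $$ (i, j) else - (\<Sum>j\<in>{k<..<n}. L $$ (i, j)))"
          proof (cases "i \<le> k")
            case True
            have "{j \<in> {..<n} - {i}. k \<in> {min i j..<max i j}} = {k<..<n}" using True by auto
            then show ?thesis using True by (simp add: sum.inter_filter[symmetric])
          next
            case False
            have le: "{j \<in> {..<n} - {i}. k \<in> {min i j..<max i j}} = {..k}" using False i by auto
            have "(\<Sum>j\<in>{..k} \<union> {k<..<n}. L $$ (i, j)) =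
                (\<Sum>j\<le>k. L $$ (i, j)) + (\<Sum>j\<in>{k<..<n}. L $$ (i, j))"
              by (rule sum.union_disjoint) auto
            moreover have "{..k} \<union> {k<..<n} = {..<n}" using 2(1) by auto
            ultimately have "(\<Sum>j\<le>k. L $$ (i, j)) = - (\<Sum>j\<in>{k<..<n}. L $$ (i, j))"
              using row_sum[OF i] by simp
            then show ?thesis
              unfolding sum.inter_filter[symmetric, OF finite_Diff[OF finite_lessThan]] le
              using False by simp
          qed
          note det' = det[unfolded eq]
          have "tpos k \<notin> T" using False by (simp add: nT)
          then have "vec_index ?w c = (- 1) ^ k * (\<Sum>j\<in>{k<..<n}. L $$ (i, j))"
            using c z unfolding 2(2) by (simp add: card det')
          then show ?thesis using row Nk by simp
        qed
      qed
    qed (use dims in simp)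
    then show ?thesis using minor_vector_in_row_span[OF B' T] by simp
  qed
  have "Matrix.row N r \<in> row_span (2 * n) B" if "r < n + 1" for r
    using row0 rowi that by (cases r) auto
  then show ?thesis unfolding N_def[symmetric] by (rule row_span_eqI[OF N B _ R])
qed

text \<open>The maximal minors of \<open>B\<close> are those of \<open>B'\<close> multiplied by a
  common determinant.\<close>

lemma minor_nonzero_transfer:
  assumes B: "B \<in> carrier_mat (n + 1) (2 * n)" and B': "B' \<in> carrier_mat (n + 1) (2 * n)"
    and eq: "row_span (2 * n) B = row_span (2 * n) B'"
    and IJ: "I \<subseteq> {..<n}" "J \<subseteq> {..<n}" "card I + card J = n + 1" and nz: "minor B I J \<noteq> 0"
  shows "minor B' I J \<noteq> 0"
proof -
  have "Matrix.row B r \<in> row_span (2 * n) B'" if "r < n + 1" for r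
    using row_span_row[OF B that] eq by simp
  then obtain A where A: "A \<in> carrier_mat (n + 1) (n + 1)" "B = A * B'"
    using factor_through_row_span[OF B B'] by blast
  show ?thesis
    using nz det_submatrix_mult[OF A(1) B', of "pos ` I \<union> tpos ` J"] submatrix_card[OF IJ(1,2)] IJ(3)
    unfolding minor_def A(2) by auto
qed

section \<open>From the Plucker vector to the theorem\<close>

lemma has_plucker_vectorE:
  assumes "has_plucker_vector n X p"
  obtains B c where "X \<in> Gr (n + 1) (2 * n)" "B \<in> carrier_mat (n + 1) (2 * n)"
    "row_span (2 * n) B = X" "c \<noteq> 0"
    "\<And>I J. I \<subseteq> {..<n} \<Longrightarrow> J \<subseteq> {..<n} \<Longrightarrow> card I + card J = n + 1 \<Longrightarrow>
      p I J = c * minor B I J"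
proof -
  from assms obtain B where B: "X \<in> Gr (n + 1) (2 * n)" "B \<in> carrier_mat (n + 1) (2 * n)"
    "row_span (2 * n) B = X" and ex: "\<exists>c. c \<noteq> 0 \<and> (\<forall>I J. I \<subseteq> {..<n} \<and> J \<subseteq> {..<n} \<and>
      card I + card J = n + 1 \<longrightarrow> p I J = c * minor B I J)"
    unfolding has_plucker_vector_def by (elim conjE bexE) (assumption | rule that)+
  from ex obtain c where c: "c \<noteq> 0" "\<forall>I J. I \<subseteq> {..<n} \<and> J \<subseteq> {..<n} \<and>
      card I + card J = n + 1 \<longrightarrow> p I J = c * minor B I J"
    by (elim exE conjE) (rule that)
  show thesis
    by (rule that[OF B c(1)]) (rule c(2)[rule_format], intro conjI)
qed

text \<open>Without groves all coordinates would vanish, whereas a matrix representing a point of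
  the Grassmannian has a nonzero maximal minor.\<close>

lemma grove_exists:
  assumes X: "has_plucker_vector n X (grove_vector n G)"
  shows "\<exists>F. grove n G F"
proof (rule ccontr)
  assume no: "\<not> ?thesis"
  then have zero: "grove_vector n G I J = 0" for I J
    by (simp add: grove_vector_def grove_measurement_def)
  obtain B c where B: "X \<in> Gr (n + 1) (2 * n)" "B \<in> carrier_mat (n + 1) (2 * n)"
      "row_span (2 * n) B = X"
    and c: "c \<noteq> 0" "\<And>I J. I \<subseteq> {..<n} \<Longrightarrow> J \<subseteq> {..<n} \<Longrightarrow> card I + card J = n + 1 \<Longrightarrow>
      grove_vector n G I J = c * minor B I J"
    by (rule has_plucker_vectorE[OF X]) (rule that)
  obtain T where T: "T \<subseteq> {..<2 * n}" "card T = n + 1" "Determinant.det (submatrix B UNIV T) \<noteq> 0"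
    using Gr_nonzero_minor[OF B] by blast
  define I where "I = {i. i < n \<and> pos i \<in> T}"
  define J where "J = {i. i < n \<and> tpos i \<in> T}"
  have IJ: "I \<subseteq> {..<n}" "J \<subseteq> {..<n}" and eq: "T = pos ` I \<union> tpos ` J"
    using index_union[OF T(1)] by (auto simp: I_def J_def)
  have "card I + card J = n + 1" using submatrix_card(1)[OF IJ] T(2) eq by simp
  then have "minor B I J = 0" using c(1) c(2)[OF IJ] zero by simp
  then show False using T(3) eq by (simp add: minor_def)
qed

theorem theorem1p3:
  fixes n :: nat
    and G :: "('v, 'e) network"
    and L :: "real mat"
    and X :: "real Matrix.vec set"
  assumes G: "planar_electrical_network n G"
    and L: "is_response_matrix n G L"
    and X: "has_plucker_vector n X (grove_vector n G)"
  shows "X \<in> U_not_shorted n \<and>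
    (\<exists>S\<in>carrier_mat n n. X = row_span (2 * n) (M_mat n S * D_mat n)) \<and>
    (\<forall>S\<in>carrier_mat n n. X = row_span (2 * n) (M_mat n S * D_mat n) \<longrightarrow>
       (P_mat n S)\<^sup>T = P_mat n S \<and> P_mat n S = L)"
proof -
  have net: "electrical_network n G" using G by (simp add: planar_electrical_network_def)
  have Lc: "L \<in> carrier_mat n n" using L by (simp add: is_response_matrix_def)
  obtain B c where XGr: "X \<in> Gr (n + 1) (2 * n)" and B: "B \<in> carrier_mat (n + 1) (2 * n)"
    "row_span (2 * n) B = X" and c: "c \<noteq> 0"
    and p: "\<And>I J. I \<subseteq> {..<n} \<Longrightarrow> J \<subseteq> {..<n} \<Longrightarrow> card I + card J = n + 1 \<Longrightarrow>
      grove_vector n G I J = c * minor B I J"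
    by (rule has_plucker_vectorE[OF X]) (rule that)
  \<comment> \<open>For \<open>n = 0\<close> a maximal minor would need one column out of
    none.\<close>
  have n: "0 < n"
  proof (rule ccontr)
    assume "\<not> 0 < n"
    then show False using Gr_nonzero_minor[OF XGr B] by auto
  qed
  define Z where "Z = grove_measurement n G (pair_partition n 0 0)"
  have Z: "Z \<noteq> 0"
    using grove_exists[OF X] rooted_measurement_pos[OF net] unfolding Z_def by fastforce
  have row_sum: "(\<Sum>j<n. L $$ (i, j)) = 0" if "i < n" for i
    by (rule response_matrix_row_sum[OF net L that])
  have sym: "L $$ (i, j) = L $$ (j, i)" if "i < n" "j < n" for i j
    by (rule response_matrix_symmetric[OF net L Z[unfolded Z_def] that])
  have full: "minor B {..<n} {k} = Z / c" if k: "k < n" for k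
    using p[of "{..<n}" "{k}"] grove_vector_full[OF k, of G] k c by (simp add: Z_def field_simps)
  have omit: "minor B ({..<n} - {i}) {k, n - 1} =
      (Z / c) * (\<Sum>j\<in>{..<n} - {i}. if k \<in> {min i j..<max i j} then L $$ (i, j) else 0)"
    if i: "i < n" and k: "k < n - 1" for i k
  proof -
    have "grove_vector n G ({..<n} - {i}) {k, n - 1} = (\<Sum>j\<in>{..<n} - {i}.
        if (k \<in> {min i j..<max i j}) \<noteq> (n - 1 \<in> {min i j..<max i j})
        then grove_measurement n G (pair_partition n i j) else 0)"
      using i k by (intro grove_vector_omit) auto
    also have "\<dots> = (\<Sum>j\<in>{..<n} - {i}. Z * (if k \<in> {min i j..<max i j} then L $$ (i, j) else 0))"
    proof (rule sum.cong[OF refl])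
      fix j assume "j \<in> {..<n} - {i}"
      then have j: "j < n" "i \<noteq> j" by auto
      \<comment> \<open>The last label never lies in the half-open interval, so the chord separates
        the two tilde labels exactly when \<open>k\<close> lies in it.\<close>
      have "n - 1 \<notin> {min i j..<max i j}" using i j by auto
      then show "(if (k \<in> {min i j..<max i j}) \<noteq> (n - 1 \<in> {min i j..<max i j})
          then grove_measurement n G (pair_partition n i j) else 0) =
        Z * (if k \<in> {min i j..<max i j} then L $$ (i, j) else 0)"
        using response_matrix_entry[OF net L i j] by (simp add: Z_def mult.commute)
    qed
    finally have "grove_vector n G ({..<n} - {i}) {k, n - 1} =
        Z * (\<Sum>j\<in>{..<n} - {i}. if k \<in> {min i j..<max i j} then L $$ (i, j) else 0)"
      by (simp only: sum_distrib_left)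
    moreover have "grove_vector n G ({..<n} - {i}) {k, n - 1} = c * minor B ({..<n} - {i}) {k, n - 1}"
      using i k by (intro p) auto
    ultimately show ?thesis using c by (simp add: field_simps)
  qed
  have S: "X = row_span (2 * n) (M_mat n (response_to_S n L) * D_mat n)"
    using row_span_response_to_S[OF n B(1) _ full omit row_sum] B(2) Z c by simp
  have P: "P_mat n (response_to_S n L) = L" by (rule P_mat_response_to_S[OF Lc row_sum sym])
  have LT: "L\<^sup>T = L" using Lc sym by (intro eq_matI) auto
  have "X \<in> U_not_shorted n"
    unfolding U_not_shorted_def
  proof (intro CollectI conjI ballI impI allI)
    show "X \<in> Gr (n + 1) (2 * n)" by (rule XGr)
    show "Omega n x y = 0" if "x \<in> X" "y \<in> X" for x y
      using row_span_MD_isotropic[OF n, of "response_to_S n L" x y] that P LT S by simp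
    fix B' k assume B': "B' \<in> carrier_mat (n + 1) (2 * n)" "row_span (2 * n) B' = X" and k: "k < n"
    show "minor B' {..<n} {k} \<noteq> 0"
      using full[OF k] Z c k B B' by (intro minor_nonzero_transfer[OF B(1) B'(1)]) auto
  qed
  moreover have "\<exists>S\<in>carrier_mat n n. X = row_span (2 * n) (M_mat n S * D_mat n)"
    using S by (intro bexI[of _ "response_to_S n L"]) (auto simp: response_to_S_def)
  moreover have "P_mat n S' = L" if "X = row_span (2 * n) (M_mat n S' * D_mat n)" for S'
    using P_mat_unique[OF n, of S' "response_to_S n L"] that S P by simp
  ultimately show ?thesis using LT by simp
qed

end
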